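(* Let $\mathcal{H}^n_{1,m}$ be the variety of $1\times(m+1)$ homogeneous autoregressive systems of McMillan degree $n$ (the single-output case $p=1$). It consists of all $1\times(m+1)$ polynomial vectors $P(s)=(f_1(s),\dots,f_{m+1}(s))$ whose entries have degree at most $n$, and is thereby identified with the projective space $\mathbb{P}^N$, $N=mn+m+n$. A system $P(s)$ is nondegenerate if $f_1(s),\dots,f_{m+1}(s)\in\mathbb{R}[s]$ are linearly independent over $\mathbb{R}$, which can only happen if $n\ge m$. In this case, identify the polynomials of degree at most $n$ with $\mathbb{R}^{n+1}$; the subspace $\mathrm{span}_{\mathbb{R}}\{f_1(s),\dots,f_{m+1}(s)\}\subset\mathbb{R}^{n+1}$ has dimension $m+1$ if and only if $P(s)$ is nondegenerate. The semi-stable orbits under the extended full feedback group $Gl_{m+1}$ coincide exactly with the set of nondegenerate systems, so that each semi-stable point describes a well-defined $(m+1)$-dimensional subspace of $\mathbb{R}^{n+1}$, and the categorical quotient $\mathcal{H}^n_{1,m}/Gl_{m+1}$ is exactly the Grassmann variety $\mathrm{Grass}(m+1,\mathbb{R}^{n+1})$ of $(m+1)$-dimensional subspaces of $\mathbb{R}^{n+1}$.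
   Context: A $1\times(m+1)$ homogeneous autoregressive system of McMillan degree $n$ is a nonzero row vector of homogeneous polynomials of degree $n$ in $(s,t)$, up to multiplication by a nonzero constant; setting $t=1$ gives the polynomial vector $P(s)$. The group $Gl_{m+1}$ acts by $P\mapsto PT^{-1}$, $T\in Gl_{m+1}$; on systems this corresponds to the group generated by output feedback, feed-forward and changes of basis in the input and output spaces (the extended full feedback group acting on the external variables). Semi-stability is in the sense of geometric invariant theory: for a reductive group $G$ acting on a projective variety $X\subset\mathbb{P}^N$, the semi-stable points form a Zariski open set $X^{ss}$ for which there is a projective variety $Y$ (the categorical quotient) and a morphism $\phi:X^{ss}\to Y$ such that every fibre $\phi^{-1}(y)$ contains exactly one closed $G$-orbit. *)

theory Defs
  imports
    "HOL-Analysis.Abstract_Topology"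
    "Jordan_Normal_Form.Gauss_Jordan_Elimination"
    "Jordan_Normal_Form.DL_Submatrix"
    "Jordan_Normal_Form.VS_Connect"
begin

section \<open>Projective space and the Zariski topology\<close>

text \<open>Homogeneous polynomial functions over the reals in the coordinates with indices in \<open>I\<close>
  (the zero polynomial is homogeneous of every degree).\<close>

inductive homogeneous :: "'i set \<Rightarrow> nat \<Rightarrow> (('i \<Rightarrow> real) \<Rightarrow> real) \<Rightarrow> bool" for I where
  zero: "homogeneous I d (\<lambda>x. 0)"
| monomial: "(\<Sum>i\<in>I. \<alpha> i) = d \<Longrightarrow> homogeneous I d (\<lambda>x. c * (\<Prod>i\<in>I. x i ^ \<alpha> i))"
| add: "homogeneous I d F \<Longrightarrow> homogeneous I d G \<Longrightarrow> homogeneous I d (\<lambda>x. F x + G x)"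

lemma homogeneous_mult:
  assumes "homogeneous I d F" and "homogeneous I e G"
  shows "homogeneous I (d + e) (\<lambda>x. F x * G x)"
  using assms
proof (induction rule: homogeneous.induct)
  case (zero d)
  then show ?case by (simp add: homogeneous.zero)
next
  case (add d F1 F2)
  have "homogeneous I (d + e) (\<lambda>x. F1 x * G x + F2 x * G x)"
    by (rule homogeneous.add) (use add in auto)
  then show ?case by (simp add: distrib_right)
next
  case (monomial \<alpha> d c)
  from monomial(2) show ?case
  proof (induction rule: homogeneous.induct)
    case (zero e)
    then show ?case by (simp add: homogeneous.zero)
  next
    case (add e G1 G2)
    have "homogeneous I (d + e) (\<lambda>x. c * (\<Prod>i\<in>I. x i ^ \<alpha> i) * G1 x + c * (\<Prod>i\<in>I. x i ^ \<alpha> i) * G2 x)"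
      by (rule homogeneous.add) (use add in auto)
    then show ?case by (simp add: distrib_left)
  next
    case (monomial \<beta> e b)
    have "homogeneous I (d + e) (\<lambda>x. (c * b) * (\<Prod>i\<in>I. x i ^ (\<alpha> i + \<beta> i)))"
      by (rule homogeneous.monomial)
        (use monomial \<open>(\<Sum>i\<in>I. \<alpha> i) = d\<close> in \<open>simp add: sum.distrib\<close>)
    then show ?case by (simp add: power_add prod.distrib mult_ac)
  qed
qed

text \<open>A point of projective space is the set of all its homogeneous coordinate vectors.
  Coordinate vectors vanish outside the index set; \<open>proj_space {..N}\<close> is the real
  \<open>N\<close>-dimensional projective space.\<close>

definition proj_point :: "('i \<Rightarrow> real) \<Rightarrow> ('i \<Rightarrow> real) set" where
  "proj_point v = {(\<lambda>i. c * v i) | c. c \<noteq> 0}"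

definition proj_space :: "'i set \<Rightarrow> ('i \<Rightarrow> real) set set" where
  "proj_space I = {proj_point v | v. (\<forall>i. i \<notin> I \<longrightarrow> v i = 0) \<and> (\<exists>i. v i \<noteq> 0)}"

definition zariski_open :: "'i set \<Rightarrow> ('i \<Rightarrow> real) set set \<Rightarrow> bool" where
  "zariski_open I U \<longleftrightarrow> (\<exists>\<F>. (\<forall>F\<in>\<F>. \<exists>d. homogeneous I d F) \<and>
     U = {p \<in> proj_space I. \<exists>F\<in>\<F>. \<forall>v\<in>p. F v \<noteq> 0})"

definition zariski :: "'i set \<Rightarrow> ('i \<Rightarrow> real) set topology" where
  "zariski I = topology (zariski_open I)"

lemma istopology_zariski: "istopology (zariski_open I)"
  unfolding istopology_def
proof (intro conjI allI impI)
  fix S T assume "zariski_open I S" "zariski_open I T"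
  then obtain A B where A: "\<forall>F\<in>A. \<exists>d. homogeneous I d F"
      "S = {p \<in> proj_space I. \<exists>F\<in>A. \<forall>v\<in>p. F v \<noteq> 0}"
    and B: "\<forall>F\<in>B. \<exists>d. homogeneous I d F"
      "T = {p \<in> proj_space I. \<exists>F\<in>B. \<forall>v\<in>p. F v \<noteq> 0}"
    unfolding zariski_open_def by auto
  let ?C = "{(\<lambda>x. F x * G x) | F G. F \<in> A \<and> G \<in> B}"
  have "\<forall>F\<in>?C. \<exists>d. homogeneous I d F"
    using A(1) B(1) homogeneous_mult by blast
  moreover have "S \<inter> T = {p \<in> proj_space I. \<exists>F\<in>?C. \<forall>v\<in>p. F v \<noteq> 0}"
  proof (intro equalityI subsetI)
    fix p assume "p \<in> S \<inter> T"
    then obtain F G where "p \<in> proj_space I" "F \<in> A" "G \<in> B"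
      "\<forall>v\<in>p. F v \<noteq> 0" "\<forall>v\<in>p. G v \<noteq> 0"
      unfolding A(2) B(2) by auto
    moreover have "(\<lambda>x. F x * G x) \<in> ?C" using calculation by blast
    ultimately show "p \<in> {p \<in> proj_space I. \<exists>F\<in>?C. \<forall>v\<in>p. F v \<noteq> 0}"
      by (intro CollectI conjI bexI[of _ "\<lambda>x. F x * G x"]) auto
  next
    fix p assume "p \<in> {p \<in> proj_space I. \<exists>F\<in>?C. \<forall>v\<in>p. F v \<noteq> 0}"
    then obtain F G where "p \<in> proj_space I" "F \<in> A" "G \<in> B" "\<forall>v\<in>p. F v * G v \<noteq> 0"
      by auto
    then show "p \<in> S \<inter> T" unfolding A(2) B(2) by auto
  qed
  ultimately show "zariski_open I (S \<inter> T)" unfolding zariski_open_def by blast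
next
  fix K :: "('a \<Rightarrow> real) set set set" assume K: "\<forall>S\<in>K. zariski_open I S"
  let ?A = "{F. (\<exists>d. homogeneous I d F) \<and> {p \<in> proj_space I. \<forall>v\<in>p. F v \<noteq> 0} \<subseteq> \<Union>K}"
  have "\<Union>K = {p \<in> proj_space I. \<exists>F\<in>?A. \<forall>v\<in>p. F v \<noteq> 0}"
  proof (intro equalityI subsetI)
    fix p assume "p \<in> \<Union>K"
    then obtain S where S: "S \<in> K" "p \<in> S" by blast
    obtain \<F> where hom: "\<forall>F\<in>\<F>. \<exists>d. homogeneous I d F"
      and S_eq: "S = {p \<in> proj_space I. \<exists>F\<in>\<F>. \<forall>v\<in>p. F v \<noteq> 0}"
      using K S(1) zariski_open_def[of I S] by blast
    from S(2) obtain F where p: "p \<in> proj_space I" and F: "F \<in> \<F>" "\<forall>v\<in>p. F v \<noteq> 0"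
      unfolding S_eq by blast
    have "{p \<in> proj_space I. \<forall>v\<in>p. F v \<noteq> 0} \<subseteq> S"
      unfolding S_eq using F(1) by blast
    then have "F \<in> ?A" using hom F(1) S(1) by blast
    with p F(2) show "p \<in> {p \<in> proj_space I. \<exists>F\<in>?A. \<forall>v\<in>p. F v \<noteq> 0}" by blast
  qed blast
  then show "zariski_open I (\<Union>K)"
    unfolding zariski_open_def by (intro exI[of _ ?A]) blast
qed

lemma openin_zariski: "openin (zariski I) = zariski_open I"
  unfolding zariski_def by (simp add: istopology_zariski topology_inverse')

lemma topspace_zariski: "topspace (zariski I) = proj_space I"
proof -
  have "homogeneous I 0 (\<lambda>x. 1 * (\<Prod>i\<in>I. x i ^ (0::nat)))"
    by (rule homogeneous.monomial) simp
  then have "homogeneous I 0 (\<lambda>x. 1)" by simp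
  then have "zariski_open I (proj_space I)"
    unfolding zariski_open_def by (intro exI[of _ "{\<lambda>x. 1}"]) auto
  moreover have "zariski_open I U \<Longrightarrow> U \<subseteq> proj_space I" for U
    unfolding zariski_open_def by auto
  ultimately show ?thesis
    unfolding topspace_def openin_zariski by blast
qed


section \<open>Varieties and morphisms\<close>

text \<open>Varieties are spaces of real points with their regular functions. \<open>regular X U\<close> is
  meaningful for open \<open>U\<close>; values of its members outside \<open>U\<close> are irrelevant.\<close>

record 'a fun_space =
  topo :: "'a topology"
  regular :: "'a set \<Rightarrow> ('a \<Rightarrow> real) set"

definition morphism :: "'a fun_space \<Rightarrow> 'b fun_space \<Rightarrow> ('a \<Rightarrow> 'b) \<Rightarrow> bool" where
  "morphism X Y f \<longleftrightarrow> continuous_map (topo X) (topo Y) f \<and>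
     (\<forall>V h. openin (topo Y) V \<and> h \<in> regular Y V \<longrightarrow>
        h \<circ> f \<in> regular X {x \<in> topspace (topo X). f x \<in> V})"

text \<open>The structure on a set \<open>X\<close> induced by an injection \<open>e\<close> into a projective space: Zariski
  topology, and functions that locally are quotients of two homogeneous polynomials of equal
  degree in the homogeneous coordinates.\<close>

definition embedded :: "'i set \<Rightarrow> ('a \<Rightarrow> ('i \<Rightarrow> real) set) \<Rightarrow> 'a set \<Rightarrow> 'a fun_space" where
  "embedded I e X = \<lparr> topo = pullback_topology X e (zariski I),
     regular = (\<lambda>U. {h. \<forall>x\<in>U. \<exists>W d F G. openin (zariski I) W \<and> e x \<in> W \<and>
        homogeneous I d F \<and> homogeneous I d G \<and>
        (\<forall>y\<in>U. e y \<in> W \<longrightarrow> (\<forall>v\<in>e y. G v \<noteq> 0 \<and> h y = F v / G v))}) \<rparr>"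

definition irreducible_in :: "'a topology \<Rightarrow> 'a set \<Rightarrow> bool" where
  "irreducible_in T X \<longleftrightarrow> X \<noteq> {} \<and>
     (\<forall>A B. closedin T A \<and> closedin T B \<and> X \<subseteq> A \<union> B \<longrightarrow> X \<subseteq> A \<or> X \<subseteq> B)"

definition projective_variety :: "'i set \<Rightarrow> ('a \<Rightarrow> ('i \<Rightarrow> real) set) \<Rightarrow> 'a set \<Rightarrow> bool" where
  "projective_variety I e X \<longleftrightarrow> finite I \<and> inj_on e X \<and>
     closedin (zariski I) (e ` X) \<and> irreducible_in (zariski I) (e ` X)"

definition open_part :: "'a fun_space \<Rightarrow> 'a set \<Rightarrow> 'a fun_space" where
  "open_part Z U = \<lparr> topo = subtopology (topo Z) U, regular = regular Z \<rparr>"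

definition isomorphic :: "'a fun_space \<Rightarrow> 'b fun_space \<Rightarrow> bool" where
  "isomorphic X Y \<longleftrightarrow> (\<exists>f g. morphism X Y f \<and> morphism Y X g \<and>
     (\<forall>x\<in>topspace (topo X). g (f x) = x) \<and> (\<forall>y\<in>topspace (topo Y). f (g y) = y))"

text \<open>Abstract varieties, not required to be irreducible or separated: glued from finitely many
  open quasi-projective pieces.\<close>

definition variety :: "'a fun_space \<Rightarrow> bool" where
  "variety Z \<longleftrightarrow> (\<exists>\<U>. finite \<U> \<and> \<Union>\<U> = topspace (topo Z) \<and>
     (\<forall>U\<in>\<U>. openin (topo Z) U \<and>
        (\<exists>(I :: nat set) A B. finite I \<and> closedin (zariski I) A \<and> openin (zariski I) B \<and>
           isomorphic (open_part Z U) (embedded I id (A \<inter> B)))) \<and>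
     (\<forall>V h. openin (topo Z) V \<longrightarrow> (h \<in> regular Z V \<longleftrightarrow> (\<forall>U\<in>\<U>. h \<in> regular Z (V \<inter> U)))))"


section \<open>Quotients\<close>

definition orbit :: "'g set \<Rightarrow> ('g \<Rightarrow> 'a \<Rightarrow> 'a) \<Rightarrow> 'a \<Rightarrow> 'a set" where
  "orbit G act x = (\<lambda>g. act g x) ` G"

text \<open>The first argument only fixes the type that carries the varieties \<open>Z\<close> in the universal
  property.\<close>

definition categorical_quotient ::
    "'z itself \<Rightarrow> 'g set \<Rightarrow> ('g \<Rightarrow> 'a \<Rightarrow> 'a) \<Rightarrow> 'a fun_space \<Rightarrow> 'b fun_space \<Rightarrow> ('a \<Rightarrow> 'b) \<Rightarrow> bool" where
  "categorical_quotient _ G act X Y \<phi> \<longleftrightarrow>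
     morphism X Y \<phi> \<and> (\<forall>g\<in>G. \<forall>x\<in>topspace (topo X). \<phi> (act g x) = \<phi> x) \<and>
     (\<forall>(Z :: 'z fun_space) f. variety Z \<and> morphism X Z f \<and>
         (\<forall>g\<in>G. \<forall>x\<in>topspace (topo X). f (act g x) = f x) \<longrightarrow>
       (\<exists>\<psi>. morphism Y Z \<psi> \<and> (\<forall>x\<in>topspace (topo X). \<psi> (\<phi> x) = f x) \<and>
          (\<forall>\<psi>'. morphism Y Z \<psi>' \<and> (\<forall>x\<in>topspace (topo X). \<psi>' (\<phi> x) = f x) \<longrightarrow>
             (\<forall>y\<in>topspace (topo Y). \<psi>' y = \<psi> y))))"

definition fibres_have_unique_closed_orbit ::
    "'g set \<Rightarrow> ('g \<Rightarrow> 'a \<Rightarrow> 'a) \<Rightarrow> 'a fun_space \<Rightarrow> 'b set \<Rightarrow> ('a \<Rightarrow> 'b) \<Rightarrow> bool" where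
  "fibres_have_unique_closed_orbit G act X Y \<phi> \<longleftrightarrow>
     (\<forall>y\<in>Y. \<exists>!S. S \<in> orbit G act ` topspace (topo X) \<and> closedin (topo X) S \<and>
        S \<subseteq> {x \<in> topspace (topo X). \<phi> x = y})"


section \<open>Autoregressive systems with one output\<close>

text \<open>Forms in \<open>(s,t)\<close> are of type \<open>real poly poly\<close>, as polynomials in \<open>t\<close> with coefficients
  in \<open>\<real>[s]\<close>.\<close>

definition form :: "nat \<Rightarrow> real poly poly \<Rightarrow> bool" where
  "form n p \<longleftrightarrow> (\<forall>i j. coeff (coeff p j) i \<noteq> 0 \<longrightarrow> i + j = n)"

definition form_rows :: "nat \<Rightarrow> nat \<Rightarrow> real poly poly mat set" where
  "form_rows n m = {R \<in> carrier_mat 1 (m + 1). \<forall>i < m + 1. form n (R $$ (0, i))}"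

definition poly_rows :: "nat \<Rightarrow> nat \<Rightarrow> real poly mat set" where
  "poly_rows n m = {P \<in> carrier_mat 1 (m + 1). \<forall>i < m + 1. degree (P $$ (0, i)) \<le> n}"

text \<open>Setting \<open>t = 1\<close>.\<close>

definition dehom :: "real poly poly mat \<Rightarrow> real poly mat" where
  "dehom R = map_mat (\<lambda>p. poly p 1) R"

text \<open>The variety of systems; a system is the class of its nonzero scalar multiples.\<close>

definition sys_class :: "real poly poly mat \<Rightarrow> real poly poly mat set" where
  "sys_class R = {[:[:c:]:] \<cdot>\<^sub>m R | c. c \<noteq> 0}"

definition AR :: "nat \<Rightarrow> nat \<Rightarrow> real poly poly mat set set" where
  "AR n m = {sys_class R | R. R \<in> form_rows n m \<and> R \<noteq> 0\<^sub>m 1 (m + 1)}"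

text \<open>The coefficient of \<open>s\<^sup>j\<close> in the \<open>i\<close>-th entry has index \<open>i * (n + 1) + j\<close>.\<close>

definition coords :: "nat \<Rightarrow> nat \<Rightarrow> real poly poly mat \<Rightarrow> nat \<Rightarrow> real" where
  "coords n m R k = (if k \<le> m * n + m + n
     then coeff (dehom R $$ (0, k div (n + 1))) (k mod (n + 1)) else 0)"

definition AR_proj :: "nat \<Rightarrow> nat \<Rightarrow> real poly poly mat set \<Rightarrow> (nat \<Rightarrow> real) set" where
  "AR_proj n m x = coords n m ` x"

definition GL :: "nat \<Rightarrow> real mat set" where
  "GL k = {T \<in> carrier_mat k k. invertible_mat T}"

definition row_act :: "real mat \<Rightarrow> real poly poly mat \<Rightarrow> real poly poly mat" where
  "row_act T R = R * map_mat (\<lambda>c. [:[:c:]:]) (the (mat_inverse T))"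

definition feedback :: "real mat \<Rightarrow> real poly poly mat set \<Rightarrow> real poly poly mat set" where
  "feedback T x = row_act T ` x"

text \<open>Semi-stability (Mumford): some invariant section of a positive power of the linearised
  line bundle does not vanish at the point. The linearisation for \<open>GL (m + 1)\<close> is \<open>\<O>(m + 1)\<close>
  twisted by the determinant. Scalar matrices act trivially on the projective space, but a
  form of degree \<open>k\<close> is multiplied by \<open>c\<^sup>-\<^sup>k\<close> under the scalar \<open>c\<close>; so up to powers this is the only
  twist that admits nonzero invariant sections. Its sections are the homogeneous polynomials
  invariant under the subgroup of matrices of determinant 1.\<close>

definition invariant_section :: "nat \<Rightarrow> nat \<Rightarrow> nat \<Rightarrow> ((nat \<Rightarrow> real) \<Rightarrow> real) \<Rightarrow> bool" where
  "invariant_section n m d F \<longleftrightarrow> homogeneous {..m * n + m + n} (d * (m + 1)) F \<and>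
     (\<forall>T \<in> GL (m + 1). \<forall>R \<in> form_rows n m.
        det T ^ d * F (coords n m (row_act T R)) = F (coords n m R))"

definition semistable :: "nat \<Rightarrow> nat \<Rightarrow> real poly poly mat set \<Rightarrow> bool" where
  "semistable n m x \<longleftrightarrow>
     (\<exists>d F. d > 0 \<and> invariant_section n m d F \<and> (\<forall>R\<in>x. F (coords n m R) \<noteq> 0))"

definition AR_ss :: "nat \<Rightarrow> nat \<Rightarrow> real poly poly mat set set" where
  "AR_ss n m = {x \<in> AR n m. semistable n m x}"

definition nondegenerate :: "nat \<Rightarrow> real poly mat \<Rightarrow> bool" where
  "nondegenerate m P \<longleftrightarrow> (\<forall>c :: nat \<Rightarrow> real.
     (\<Sum>i < m + 1. Polynomial.smult (c i) (P $$ (0, i))) = 0 \<longrightarrow> (\<forall>i < m + 1. c i = 0))"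


definition AR_ss_space :: "nat \<Rightarrow> nat \<Rightarrow> real poly poly mat set fun_space" where
  "AR_ss_space n m = embedded {..m * n + m + n} (AR_proj n m) (AR_ss n m)"


section \<open>The Grassmann variety\<close>

definition coeff_vec :: "nat \<Rightarrow> real poly \<Rightarrow> real vec" where
  "coeff_vec n p = vec (n + 1) (coeff p)"

definition poly_span :: "nat \<Rightarrow> nat \<Rightarrow> real poly mat \<Rightarrow> real vec set" where
  "poly_span n m P = LinearCombinations.module.span class_ring (module_vec TYPE(real) (n + 1))
     ((\<lambda>i. coeff_vec n (P $$ (0, i))) ` {..<m + 1})"

definition subspace_dim :: "nat \<Rightarrow> real vec set \<Rightarrow> nat" where
  "subspace_dim N W = vectorspace.dim class_ring ((module_vec TYPE(real) N)\<lparr>carrier := W\<rparr>)"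

definition Grass :: "nat \<Rightarrow> nat \<Rightarrow> real vec set set" where
  "Grass k N = {W. VectorSpace.subspace class_ring W (module_vec TYPE(real) N) \<and> subspace_dim N W = k}"

text \<open>Pluecker embedding: the maximal minors of the matrices whose rows form a basis of \<open>W\<close>.
  Two such matrices differ by an invertible factor, and every nonzero scalar is the determinant of
  such a factor, so for \<open>W\<close> in \<open>Grass k N\<close> with \<open>k > 0\<close> this set is a projective point.\<close>

definition pluecker_index :: "nat \<Rightarrow> nat \<Rightarrow> nat set set" where
  "pluecker_index k N = {J. J \<subseteq> {..<N} \<and> card J = k}"

definition minors :: "nat \<Rightarrow> nat \<Rightarrow> real mat \<Rightarrow> nat set \<Rightarrow> real" where
  "minors k N A J = (if J \<in> pluecker_index k N then det (submatrix A UNIV J) else 0)"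

definition pluecker :: "nat \<Rightarrow> nat \<Rightarrow> real vec set \<Rightarrow> (nat set \<Rightarrow> real) set" where
  "pluecker k N W = {minors k N A | A. A \<in> carrier_mat k N \<and> vec_space.row_space N A = W}"

definition Grass_space :: "nat \<Rightarrow> nat \<Rightarrow> real vec set fun_space" where
  "Grass_space k N = embedded (pluecker_index k N) (pluecker k N) (Grass k N)"

text \<open>The subspace described by a system, where all representatives span the same one.\<close>

definition sys_subspace :: "nat \<Rightarrow> nat \<Rightarrow> real poly poly mat set \<Rightarrow> real vec set" where
  "sys_subspace n m x = (THE W. \<forall>R\<in>x. poly_span n m (dehom R) = W)"

end

(* A system with p = 1 is a nonzero (m+1) x (n+1) coefficient matrix A up to scalars, on which
   feedback acts by left multiplication. The maximal minors of A are semi-invariants, and a matrix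
   with dependent rows is fixed by a matrix of determinant 2, so all its semi-invariants vanish;
   hence semi-stable means full row rank. Full-rank matrices with equal row spaces differ by an
   invertible factor, so the orbits are the fibres of the row space map, which in Pluecker
   coordinates is given by the minors. Conversely, Cramer's rule recovers from the Pluecker
   coordinates p of a row space, where p J is nonzero, a matrix with that row space whose entries
   are up to sign coordinates of p. This linear local section makes every invariant morphism
   descend, and p lies in the Grassmannian iff the minors of these matrices are proportional to p,
   which are polynomial equations and avoid the quadratic Pluecker relations. *)

theory Submission
  imports Defs "Jordan_Normal_Form.DL_Rank"
begin

section \<open>Homogeneous polynomial functions\<close>

text \<open>Only real points occur, so nothing may rest on an algebraically closed field or on
  generators of a ring of invariants; the universal property is verified directly. Both halves of
  it, that the row space map is a morphism and that invariant morphisms factor through it by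
  morphisms, are instances of one criterion: a map that near each point equals a given morphism
  after a polynomial substitution in the homogeneous coordinates is itself a morphism. Local
  sections of the row space map suffice for this, because the factorised map is already determined
  as a map of sets and nothing has to be glued. The Cramer formula must make sense for every
  coordinate vector, not only for those that come from a matrix. Hence the signs of reordered minors
  are fixed independently of any matrix; this lets one formula serve for descent, for the
  injectivity of the embedding and for the equations of its image. The number 2 arises because
  adding a normalised linear relation among the rows to a unit vector doubles one entry. Orbits are
  closed because each is the full preimage of a closed point.\<close>

lemma homogeneous_const: "homogeneous I 0 (\<lambda>x. c)"
  using homogeneous.monomial[where I = I and \<alpha> = "\<lambda>_. 0" and d = 0 and c = c] by simp

lemma homogeneous_coord:
  assumes "finite I" "i \<in> I"
  shows "homogeneous I 1 (\<lambda>x. x i)"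
proof -
  have "homogeneous I 1 (\<lambda>x. 1 * (\<Prod>j\<in>I. x j ^ (if j = i then 1 else 0)))"
    by (rule homogeneous.monomial) (use assms in simp)
  moreover have "(\<Prod>j\<in>I. x j ^ (if j = i then 1 else 0)) = x i" for x :: "'a \<Rightarrow> real"
  proof -
    have "(\<Prod>j\<in>I. x j ^ (if j = i then 1 else 0)) = (\<Prod>j\<in>I. if j = i then x j else 1)"
      by (rule prod.cong) auto
    with assms show ?thesis by simp
  qed
  ultimately show ?thesis by simp
qed

lemma homogeneous_smult: "homogeneous I d F \<Longrightarrow> homogeneous I d (\<lambda>x. c * F x)"
  using homogeneous_mult[OF homogeneous_const, of I d F c] by simp

lemma homogeneous_diff:
  "homogeneous I d F \<Longrightarrow> homogeneous I d G \<Longrightarrow> homogeneous I d (\<lambda>x. F x - G x)"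
  using homogeneous.add[OF _ homogeneous_smult[where c = "-1"], of I d F G] by simp

lemma homogeneous_sum:
  "(\<And>k. k \<in> K \<Longrightarrow> homogeneous I d (F k)) \<Longrightarrow> homogeneous I d (\<lambda>x. \<Sum>k\<in>K. F k x)"
  by (induction K rule: infinite_finite_induct) (auto intro: homogeneous.zero homogeneous.add)

lemma homogeneous_prod:
  "finite K \<Longrightarrow> (\<And>k. k \<in> K \<Longrightarrow> homogeneous I (d k) (F k)) \<Longrightarrow>
    homogeneous I (\<Sum>k\<in>K. d k) (\<lambda>x. \<Prod>k\<in>K. F k x)"
  by (induction K rule: finite_induct) (auto intro: homogeneous_const homogeneous_mult)

lemma homogeneous_power:
  "homogeneous I d F \<Longrightarrow> homogeneous I (k * d) (\<lambda>x. F x ^ k)"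
  using homogeneous_prod[where K = "{..<k}" and d = "\<lambda>_. d" and F = "\<lambda>_. F"] by simp

text \<open>Monomials over \<open>I\<close> see only the coordinates in \<open>I\<close>, so only
  these components of \<open>g\<close> have to be forms. Degrees multiply because all components
  share the degree \<open>e\<close>.\<close>

lemma homogeneous_subst:
  assumes "homogeneous I d F" and "finite I"
    and g: "\<And>i. i \<in> I \<Longrightarrow> homogeneous J e (\<lambda>x. g x i)"
  shows "homogeneous J (d * e) (\<lambda>x. F (g x))"
  using assms(1)
proof (induction rule: homogeneous.induct)
  case (zero d)
  show ?case by (rule homogeneous.zero)
next
  case (monomial \<alpha> d c)
  have "homogeneous J (\<Sum>i\<in>I. \<alpha> i * e) (\<lambda>x. \<Prod>i\<in>I. g x i ^ \<alpha> i)"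
    by (rule homogeneous_prod[OF \<open>finite I\<close>]) (rule homogeneous_power[OF g])
  then show ?case
    using monomial by (auto intro!: homogeneous_smult simp flip: sum_distrib_right)
next
  case (add d F G)
  then show ?case by (intro homogeneous.add)
qed

lemma homogeneous_scale:
  assumes "homogeneous I d F"
  shows "F (\<lambda>i. c * v i) = c ^ d * F v"
  using assms
proof (induction rule: homogeneous.induct)
  case (monomial \<alpha> d b)
  then show ?case
    by (auto simp: power_mult_distrib prod.distrib power_sum)
qed (simp_all add: algebra_simps)

text \<open>Only polynomiality in the parameter of the line is recorded: what matters later is that
  a nonzero polynomial in one real variable does not vanish everywhere.\<close>

lemma homogeneous_on_line:
  assumes "homogeneous I d F"
  shows "\<exists>q. \<forall>t. poly q t = F (\<lambda>i. a i + t * (b i - a i))"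
  using assms
proof (induction rule: homogeneous.induct)
  case (zero d)
  show ?case by (rule exI[of _ 0]) simp
next
  case (monomial \<alpha> d c)
  show ?case
    by (rule exI[of _ "Polynomial.smult c (\<Prod>i\<in>I. [:a i, b i - a i:] ^ \<alpha> i)"])
      (simp add: poly_prod)
next
  case (add d F G)
  then obtain q r where "\<forall>t. poly q t = F (\<lambda>i. a i + t * (b i - a i))"
    "\<forall>t. poly r t = G (\<lambda>i. a i + t * (b i - a i))" by blast
  then show ?case by (intro exI[of _ "q + r"]) simp
qed


section \<open>Zariski topology\<close>

lemma proj_point_self: "v \<in> proj_point v"
  unfolding proj_point_def by (intro CollectI exI[of _ 1]) auto

lemma proj_point_scale:
  assumes "c \<noteq> 0"
  shows "proj_point (\<lambda>i. c * v i) = proj_point v"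
proof -
  have "\<exists>b'. (\<lambda>i. b * v i) = (\<lambda>i. b' * (c * v i)) \<and> b' \<noteq> 0" if "b \<noteq> 0" for b
    using assms that by (intro exI[of _ "b / c"]) auto
  moreover have "\<exists>b'. (\<lambda>i. b * (c * v i)) = (\<lambda>i. b' * v i) \<and> b' \<noteq> 0" if "b \<noteq> 0" for b
    using assms that by (intro exI[of _ "b * c"]) auto
  ultimately show ?thesis
    unfolding proj_point_def by blast
qed

lemma proj_spaceD:
  assumes "p \<in> proj_space I" "v \<in> p"
  shows "p = proj_point v" "i \<notin> I \<Longrightarrow> v i = 0" "\<exists>i. v i \<noteq> 0"
proof -
  obtain w where w: "p = proj_point w" "\<forall>i. i \<notin> I \<longrightarrow> w i = 0" "\<exists>i. w i \<noteq> 0"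
    using assms(1) unfolding proj_space_def by auto
  obtain c where "c \<noteq> 0" "v = (\<lambda>i. c * w i)"
    using assms(2) unfolding w(1) proj_point_def by auto
  then show "p = proj_point v" "i \<notin> I \<Longrightarrow> v i = 0" "\<exists>i. v i \<noteq> 0"
    using w proj_point_scale by auto
qed

lemma proj_space_nonempty: "p \<in> proj_space I \<Longrightarrow> \<exists>v. v \<in> p"
  unfolding proj_space_def using proj_point_self by auto

lemma proj_point_in_proj_space:
  "(\<And>i. i \<notin> I \<Longrightarrow> v i = 0) \<Longrightarrow> v i \<noteq> 0 \<Longrightarrow> proj_point v \<in> proj_space I"
  unfolding proj_space_def by auto

lemma homogeneous_nonzero_on_point:
  assumes "homogeneous I' d F" "p \<in> proj_space I" "v \<in> p" "w \<in> p" "F v \<noteq> 0"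
  shows "F w \<noteq> 0"
proof -
  obtain c where "c \<noteq> 0" "w = (\<lambda>i. c * v i)"
    using assms(4) proj_spaceD(1)[OF assms(2,3)] unfolding proj_point_def by auto
  then show ?thesis using homogeneous_scale[OF assms(1)] assms(5) by simp
qed

text \<open>Nonvanishing of a form does not depend on the representative, so the quantifier over all
  coordinate vectors of a point can be traded for a single vector.\<close>

lemma zariski_openI:
  assumes "\<And>F. F \<in> \<F> \<Longrightarrow> \<exists>d. homogeneous I d F"
    and "\<And>p v. p \<in> proj_space I \<Longrightarrow> v \<in> p \<Longrightarrow> p \<in> U \<longleftrightarrow> (\<exists>F\<in>\<F>. F v \<noteq> 0)"
    and "U \<subseteq> proj_space I"
  shows "zariski_open I U"
  unfolding zariski_open_def
proof (intro exI[of _ \<F>] conjI ballI equalityI subsetI)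
  fix p assume p: "p \<in> U"
  with assms(3) have ps: "p \<in> proj_space I" by blast
  then obtain v where v: "v \<in> p" using proj_space_nonempty by blast
  with assms(2)[OF ps] p obtain F where F: "F \<in> \<F>" "F v \<noteq> 0" by blast
  with assms(1) obtain d where "homogeneous I d F" by blast
  with F v ps show "p \<in> {p \<in> proj_space I. \<exists>F\<in>\<F>. \<forall>v\<in>p. F v \<noteq> 0}"
    using homogeneous_nonzero_on_point by blast
next
  fix p assume "p \<in> {p \<in> proj_space I. \<exists>F\<in>\<F>. \<forall>v\<in>p. F v \<noteq> 0}"
  then show "p \<in> U" using assms(2) proj_space_nonempty[of p I] by blast
qed (use assms(1) in blast)

lemma zariski_openE:
  assumes "zariski_open I U"
  obtains \<F> where "\<And>F. F \<in> \<F> \<Longrightarrow> \<exists>d. homogeneous I d F"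
    and "\<And>p v. p \<in> proj_space I \<Longrightarrow> v \<in> p \<Longrightarrow> p \<in> U \<longleftrightarrow> (\<exists>F\<in>\<F>. F v \<noteq> 0)"
    and "U \<subseteq> proj_space I"
proof -
  obtain \<F> where hom: "\<forall>F\<in>\<F>. \<exists>d. homogeneous I d F"
    and U: "U = {p \<in> proj_space I. \<exists>F\<in>\<F>. \<forall>v\<in>p. F v \<noteq> 0}"
    using assms unfolding zariski_open_def by blast
  have "p \<in> U \<longleftrightarrow> (\<exists>F\<in>\<F>. F v \<noteq> 0)" if p: "p \<in> proj_space I" "v \<in> p" for p v
  proof -
    have "\<forall>w\<in>p. F w \<noteq> 0" if "F \<in> \<F>" "F v \<noteq> 0" for F
      using hom homogeneous_nonzero_on_point p that by blast
    then show ?thesis unfolding U using p by blast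
  qed
  then show ?thesis using that[of \<F>] hom U by blast
qed

text \<open>The substitution \<open>g\<close> need not give a projective point everywhere, as it may
  vanish. Multiplying each pulled back form \<open>F\<close> by \<open>D\<close> confines the open
  set to the locus \<open>D v \<noteq> 0\<close>, where the target point is under control.\<close>

lemma zariski_open_pullback:
  assumes "finite I" "zariski_open I U" and D: "homogeneous J d D"
    and g: "\<And>i. i \<in> I \<Longrightarrow> homogeneous J e (\<lambda>v. g v i)"
  obtains U' where "zariski_open J U'"
    and "\<And>p v. p \<in> U' \<Longrightarrow> v \<in> p \<Longrightarrow> D v \<noteq> 0"
    and "\<And>p q v. p \<in> proj_space J \<Longrightarrow> q \<in> proj_space I \<Longrightarrow> v \<in> p \<Longrightarrow> g v \<in> q \<Longrightarrow> D v \<noteq> 0 \<Longrightarrow>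
      p \<in> U' \<longleftrightarrow> q \<in> U"
proof -
  obtain \<F> where hom: "\<And>F. F \<in> \<F> \<Longrightarrow> \<exists>d. homogeneous I d F"
    and U: "\<And>p v. p \<in> proj_space I \<Longrightarrow> v \<in> p \<Longrightarrow> p \<in> U \<longleftrightarrow> (\<exists>F\<in>\<F>. F v \<noteq> 0)"
    using zariski_openE[OF assms(2)] by metis
  let ?\<F> = "(\<lambda>F v. D v * F (g v)) ` \<F>"
  define U' where "U' = {p \<in> proj_space J. \<exists>v\<in>p. \<exists>F\<in>?\<F>. F v \<noteq> 0}"
  have hom': "\<exists>d. homogeneous J d F" if F: "F \<in> ?\<F>" for F
  proof -
    obtain G where G: "G \<in> \<F>" "F = (\<lambda>v. D v * G (g v))"
      using F by (elim imageE)
    obtain c where "homogeneous I c G" using hom[OF G(1)] by blast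
    from homogeneous_mult[OF D homogeneous_subst[where g = g, OF this assms(1) g]]
    show ?thesis unfolding G(2) by (rule exI)
  qed
  have U': "p \<in> U' \<longleftrightarrow> (\<exists>F\<in>?\<F>. F v \<noteq> 0)" if "p \<in> proj_space J" "v \<in> p" for p v
  proof
    assume "p \<in> U'"
    then have "\<exists>v\<in>p. \<exists>F\<in>?\<F>. F v \<noteq> 0" unfolding U'_def by (rule CollectE) (rule conjunct2)
    then obtain w F where w: "w \<in> p" "F \<in> ?\<F>" "F w \<noteq> 0" by (elim bexE)
    from hom'[OF w(2)] obtain c where "homogeneous J c F" ..
    from homogeneous_nonzero_on_point[OF this that(1) w(1) that(2) w(3)] w(2)
    show "\<exists>F\<in>?\<F>. F v \<noteq> 0" by (rule bexI)
  next
    assume "\<exists>F\<in>?\<F>. F v \<noteq> 0"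
    then have "\<exists>v\<in>p. \<exists>F\<in>?\<F>. F v \<noteq> 0" using that(2) by (rule bexI)
    with that(1) show "p \<in> U'" unfolding U'_def by (intro CollectI conjI)
  qed
  show ?thesis
  proof (rule that)
    show "zariski_open J U'"
    proof (rule zariski_openI[of ?\<F>])
      show "U' \<subseteq> proj_space J" unfolding U'_def by (rule Collect_restrict)
    qed (fact hom', fact U')
    show "D v \<noteq> 0" if "p \<in> U'" "v \<in> p" for p v
    proof -
      have "p \<in> proj_space J" using that(1) unfolding U'_def by (rule CollectE) (rule conjunct1)
      with U'[OF this that(2)] that(1) show ?thesis by auto
    qed
    show "p \<in> U' \<longleftrightarrow> q \<in> U"
      if "p \<in> proj_space J" "q \<in> proj_space I" "v \<in> p" "g v \<in> q" "D v \<noteq> 0" for p q v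
      using U'[OF that(1,3)] U[OF that(2,4)] that(5) by simp
  qed
qed

lemma closedin_zariski_zero_locus:
  assumes "\<And>F. F \<in> \<F> \<Longrightarrow> \<exists>d. homogeneous I d F" "S \<subseteq> proj_space I"
    and "\<And>p v. p \<in> proj_space I \<Longrightarrow> v \<in> p \<Longrightarrow> p \<in> S \<longleftrightarrow> (\<forall>F\<in>\<F>. F v = 0)"
  shows "closedin (zariski I) S"
  unfolding closedin_def topspace_zariski openin_zariski
proof
  show "zariski_open I (proj_space I - S)"
  proof (rule zariski_openI[of \<F>])
    show "p \<in> proj_space I - S \<longleftrightarrow> (\<exists>F\<in>\<F>. F v \<noteq> 0)" if "p \<in> proj_space I" "v \<in> p" for p v
      using assms(3)[OF that] that(1) by blast
  qed (use assms(1) in blast)+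
qed fact

text \<open>The equations are the 2 x 2 minors of the pair \<open>w\<close>, \<open>v\<close>; they
  vanish exactly when \<open>v\<close> is proportional to the fixed vector \<open>w\<close>.\<close>

lemma closedin_zariski_point:
  assumes "finite I" "p \<in> proj_space I"
  shows "closedin (zariski I) {p}"
proof -
  obtain w where w: "w \<in> p" using assms(2) proj_space_nonempty by blast
  note wp = proj_spaceD[OF assms(2) w]
  let ?\<F> = "{\<lambda>v. w j * v i - w i * v j | i j. i \<in> I \<and> j \<in> I}"
  show ?thesis
  proof (rule closedin_zariski_zero_locus[of ?\<F>])
    show "\<exists>d. homogeneous I d F" if F: "F \<in> ?\<F>" for F
    proof -
      obtain i j where F: "F = (\<lambda>v. w j * v i - w i * v j)" and "i \<in> I" "j \<in> I" using F by blast
      then have "homogeneous I 1 (\<lambda>v. w j * v i - w i * v j)"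
        by (intro homogeneous_diff[OF homogeneous_smult homogeneous_smult] homogeneous_coord assms(1))
      then show ?thesis unfolding F by blast
    qed
    show "{p} \<subseteq> proj_space I" using assms(2) by simp
    fix q v assume q: "q \<in> proj_space I" "v \<in> q"
    note vq = proj_spaceD[OF q]
    show "q \<in> {p} \<longleftrightarrow> (\<forall>F\<in>?\<F>. F v = 0)"
    proof
      assume "q \<in> {p}"
      then obtain c where "v = (\<lambda>i. c * w i)"
        using q(2) wp(1) unfolding proj_point_def by auto
      then show "\<forall>F\<in>?\<F>. F v = 0" by auto
    next
      assume "\<forall>F\<in>?\<F>. F v = 0"
      then have rel: "w j * v i = w i * v j" if "i \<in> I" "j \<in> I" for i j
        using that by force
      obtain i where i: "w i \<noteq> 0" using wp(3) by blast
      then have "i \<in> I" using wp(2) by blast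
      \<comment> \<open>The ratio at one nonzero coordinate of \<open>w\<close> is the factor of
        proportionality; outside \<open>I\<close> both vectors vanish.\<close>
      have v: "v = (\<lambda>j. (v i / w i) * w j)"
      proof
        fix j show "v j = (v i / w i) * w j"
          using rel[OF \<open>i \<in> I\<close>, of j] i wp(2)[of j] vq(2)[of j] by (cases "j \<in> I") (auto simp: field_simps)
      qed
      then have "v i / w i \<noteq> 0" using vq(3) by (metis mult_zero_left)
      with v have "proj_point v = proj_point w" using proj_point_scale by metis
      then show "q \<in> {p}" using vq(1) wp(1) by simp
    qed
  qed
qed

text \<open>The form certifies non-membership in \<open>C\<close> at every point where it is
  nonzero, not only at \<open>p\<close>. This allows the certificate to be moved along a
  line.\<close>

lemma closedin_zariski_separating_form:
  assumes "closedin (zariski I) C" "p \<in> proj_space I" "p \<notin> C" "v \<in> p"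
  obtains F d where "homogeneous I d F" "F v \<noteq> 0"
    "\<forall>q\<in>proj_space I. \<forall>w\<in>q. F w \<noteq> 0 \<longrightarrow> q \<notin> C"
proof -
  have "zariski_open I (proj_space I - C)"
    using assms(1) unfolding closedin_def topspace_zariski openin_zariski by blast
  then obtain \<F> where hom: "\<And>F. F \<in> \<F> \<Longrightarrow> \<exists>d. homogeneous I d F"
    and U: "\<And>p v. p \<in> proj_space I \<Longrightarrow> v \<in> p \<Longrightarrow>
      p \<in> proj_space I - C \<longleftrightarrow> (\<exists>F\<in>\<F>. F v \<noteq> 0)"
    by (elim zariski_openE) (rule that)
  have "\<exists>F\<in>\<F>. F v \<noteq> 0" by (rule iffD1[OF U[OF assms(2,4)]]) (use assms(2,3) in simp)
  then obtain F where F: "F \<in> \<F>" "F v \<noteq> 0" by (rule bexE)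
  from hom[OF F(1)] obtain d where "homogeneous I d F" ..
  moreover have "\<forall>q\<in>proj_space I. \<forall>w\<in>q. F w \<noteq> 0 \<longrightarrow> q \<notin> C"
  proof (intro ballI impI)
    fix q w assume q: "q \<in> proj_space I" "w \<in> q" "F w \<noteq> 0"
    from q(3) F(1) have "\<exists>F\<in>\<F>. F w \<noteq> 0" by (rule bexI)
    then have "q \<in> proj_space I - C" by (rule iffD2[OF U[OF q(1,2)]])
    then show "q \<notin> C" by simp
  qed
  ultimately show ?thesis using F(2) that by simp
qed

text \<open>A parametrisation by polynomials is restricted to the line through two parameters, where
  nonvanishing conditions become nonzero polynomials in one variable and hence hold
  simultaneously.\<close>

lemma irreducible_in_zariskiI:
  assumes "finite I" "S \<noteq> {}" "S \<subseteq> proj_space I"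
    and g: "\<And>i. i \<in> I \<Longrightarrow> homogeneous J e (\<lambda>a. g a i)"
    and param: "\<And>p. p \<in> S \<Longrightarrow> \<exists>D d a. homogeneous J d D \<and> D a \<noteq> 0 \<and> g a \<in> p \<and>
      (\<forall>b. D b \<noteq> 0 \<longrightarrow> (\<exists>q\<in>S. g b \<in> q))"
  shows "irreducible_in (zariski I) S"
  unfolding irreducible_in_def
proof (intro conjI allI impI)
  fix A B assume AB: "closedin (zariski I) A \<and> closedin (zariski I) B \<and> S \<subseteq> A \<union> B"
  show "S \<subseteq> A \<or> S \<subseteq> B"
  proof (rule ccontr)
    assume "\<not> ?thesis"
    then obtain p1 p2 where p: "p1 \<in> S - A" "p2 \<in> S - B" by blast
    then have "p1 \<in> S" "p2 \<in> S" by blast+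
    from param[OF this(1)] obtain D d a where D: "homogeneous J d D" "D a \<noteq> 0" "g a \<in> p1"
      "\<forall>b. D b \<noteq> 0 \<longrightarrow> (\<exists>q\<in>S. g b \<in> q)"
      by (elim exE conjE)
    from param[OF \<open>p2 \<in> S\<close>] obtain b where b: "g b \<in> p2" by (elim exE conjE)
    from AB have closed: "closedin (zariski I) A" "closedin (zariski I) B" by blast+
    have ps: "p1 \<in> proj_space I" "p2 \<in> proj_space I" and out: "p1 \<notin> A" "p2 \<notin> B"
      using p assms(3) by blast+
    from closedin_zariski_separating_form[OF closed(1) ps(1) out(1) D(3)] obtain F dF
      where F: "homogeneous I dF F" "F (g a) \<noteq> 0"
        "\<forall>q\<in>proj_space I. \<forall>w\<in>q. F w \<noteq> 0 \<longrightarrow> q \<notin> A" .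
    from closedin_zariski_separating_form[OF closed(2) ps(2) out(2) b] obtain G dG
      where G: "homogeneous I dG G" "G (g b) \<noteq> 0"
        "\<forall>q\<in>proj_space I. \<forall>w\<in>q. G w \<noteq> 0 \<longrightarrow> q \<notin> B" .
    let ?line = "\<lambda>t i. a i + t * (b i - a i)"
    obtain qF where qF: "\<And>t. poly qF t = F (g (?line t))"
      using homogeneous_on_line[OF homogeneous_subst[where g = g, OF F(1) assms(1) g], of a b] by blast
    obtain qG where qG: "\<And>t. poly qG t = G (g (?line t))"
      using homogeneous_on_line[OF homogeneous_subst[where g = g, OF G(1) assms(1) g], of a b] by blast
    obtain qD where qD: "\<And>t. poly qD t = D (?line t)"
      using homogeneous_on_line[OF D(1), of a b] by blast
    \<comment> \<open>The value \<open>t = 0\<close> is the parameter of \<open>p1\<close> and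
      \<open>t = 1\<close> that of \<open>p2\<close>, so each of the three polynomials is nonzero
      for its own reason. Their product then has a nonroot.\<close>
    have "qF \<noteq> 0" using qF[of 0] F(2) by auto
    moreover have "qG \<noteq> 0" using qG[of 1] G(2) by auto
    moreover have "qD \<noteq> 0" using qD[of 0] D(2) by auto
    ultimately have "qF * qG * qD \<noteq> 0" by simp
    then obtain t where "poly (qF * qG * qD) t \<noteq> 0"
      using poly_all_0_iff_0[of "qF * qG * qD"] by blast
    then have nz: "F (g (?line t)) \<noteq> 0" "G (g (?line t)) \<noteq> 0" "D (?line t) \<noteq> 0"
      using qF qG qD by auto
    from D(4)[rule_format, OF nz(3)] obtain q where q: "q \<in> S" "g (?line t) \<in> q" ..
    then have ps: "q \<in> proj_space I" using assms(3) by blast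
    have "q \<notin> A" by (rule F(3)[rule_format, OF ps q(2) nz(1)])
    moreover have "q \<notin> B" by (rule G(3)[rule_format, OF ps q(2) nz(2)])
    ultimately show False using AB q(1) by blast
  qed
qed (fact assms(2))


section \<open>Morphisms between embedded spaces\<close>

lemma openin_embedded:
  "openin (topo (embedded I e X)) S \<longleftrightarrow> (\<exists>U. zariski_open I U \<and> S = {x \<in> X. e x \<in> U})"
  unfolding embedded_def by (auto simp: openin_pullback_topology openin_zariski)

lemma topspace_embedded:
  "e ` X \<subseteq> proj_space I \<Longrightarrow> topspace (topo (embedded I e X)) = X"
  unfolding embedded_def by (auto simp: topspace_pullback_topology topspace_zariski)

lemma regular_embedded:
  "h \<in> regular (embedded I e X) U \<longleftrightarrow> (\<forall>x\<in>U. \<exists>W d F G. zariski_open I W \<and> e x \<in> W \<and>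
     homogeneous I d F \<and> homogeneous I d G \<and>
     (\<forall>y\<in>U. e y \<in> W \<longrightarrow> (\<forall>v\<in>e y. G v \<noteq> 0 \<and> h y = F v / G v)))"
  unfolding embedded_def by (simp add: openin_zariski)

lemma closedin_embedded_preimage:
  assumes "e ` X \<subseteq> proj_space I" "closedin (zariski I) C"
  shows "closedin (topo (embedded I e X)) {x \<in> X. e x \<in> C}"
  unfolding closedin_def topspace_embedded[OF assms(1)] openin_embedded
proof (intro conjI exI[of _ "proj_space I - C"])
  show "zariski_open I (proj_space I - C)"
    using assms(2) unfolding closedin_def topspace_zariski openin_zariski by blast
qed (use assms(1) in auto)

lemma morphism_id: "morphism X X (\<lambda>x. x)"
  unfolding morphism_def
proof (intro conjI allI impI)
  fix V h assume V: "openin (topo X) V \<and> h \<in> regular X V"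
  then have "{x \<in> topspace (topo X). x \<in> V} = V" using openin_subset by blast
  with V show "h \<circ> (\<lambda>x. x) \<in> regular X {x \<in> topspace (topo X). x \<in> V}"
    by (simp add: comp_def)
qed simp

text \<open>Openness and regularity may be tested near each point, so it is enough that near each
  \<open>y\<close> the map \<psi> is \<open>f\<close> after a substitution \<open>g\<close> of
  forms. The point \<open>x\<close> with coordinate vector \<open>g v\<close> may depend on the
  representative \<open>v\<close>; only the value \<open>f x\<close> has to agree with
  \<psi>.\<close>

lemma morphism_local_lift:
  assumes "finite I" and eX: "eX ` X \<subseteq> proj_space I" and eY: "eY ` Y \<subseteq> proj_space J"
    and f: "morphism (embedded I eX X) Z f"
    and lift: "\<And>y. y \<in> Y \<Longrightarrow> \<exists>D g d e. homogeneous J d D \<and>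
      (\<forall>i\<in>I. homogeneous J e (\<lambda>v. g v i)) \<and> (\<forall>v\<in>eY y. D v \<noteq> 0) \<and>
      (\<forall>y'\<in>Y. \<forall>v\<in>eY y'. D v \<noteq> 0 \<longrightarrow> (\<exists>x\<in>X. g v \<in> eX x \<and> \<psi> y' = f x))"
  shows "morphism (embedded J eY Y) Z \<psi>"
proof -
  note topX = topspace_embedded[OF eX]
  note topY = topspace_embedded[OF eY]
  have eX_ps: "eX x \<in> proj_space I" if "x \<in> X" for x using that eX by blast
  have eY_ps: "eY y \<in> proj_space J" if "y \<in> Y" for y using that eY by blast
  have point: "\<exists>v. v \<in> eY y" if "y \<in> Y" for y
    using proj_space_nonempty that eY by blast
  have f_cont: "\<exists>U. zariski_open I U \<and> {x \<in> X. f x \<in> V} = {x \<in> X. eX x \<in> U}"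
    if "openin (topo Z) V" for V
    using f that unfolding morphism_def continuous_map_def topX openin_embedded by blast
  show ?thesis
    unfolding morphism_def continuous_map_def topY
  proof (intro conjI allI impI funcsetI)
    fix y assume "y \<in> Y"
    with lift[OF this] point obtain x where "x \<in> X" "\<psi> y = f x" by blast
    then show "\<psi> y \<in> topspace (topo Z)"
      using f unfolding morphism_def continuous_map_def topX by auto
  next
    fix V assume V: "openin (topo Z) V"
    from f_cont[OF V] obtain U where U: "zariski_open I U"
      and UV: "\<And>x. x \<in> X \<Longrightarrow> f x \<in> V \<longleftrightarrow> eX x \<in> U" by blast
    show "openin (topo (embedded J eY Y)) {y \<in> Y. \<psi> y \<in> V}"
    proof (subst openin_subopen, intro ballI)
      fix y assume "y \<in> {y \<in> Y. \<psi> y \<in> V}"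
      then have y: "y \<in> Y" "\<psi> y \<in> V" by auto
      from lift[OF y(1)] obtain D g d e where D: "homogeneous J d D" "\<forall>v\<in>eY y. D v \<noteq> 0"
        and g: "\<And>i. i \<in> I \<Longrightarrow> homogeneous J e (\<lambda>v. g v i)"
        and gf: "\<And>y' v. y' \<in> Y \<Longrightarrow> v \<in> eY y' \<Longrightarrow> D v \<noteq> 0 \<Longrightarrow> \<exists>x\<in>X. g v \<in> eX x \<and> \<psi> y' = f x"
        by blast
      obtain U' where U': "zariski_open J U'" "\<And>p v. p \<in> U' \<Longrightarrow> v \<in> p \<Longrightarrow> D v \<noteq> 0"
        "\<And>p q v. p \<in> proj_space J \<Longrightarrow> q \<in> proj_space I \<Longrightarrow> v \<in> p \<Longrightarrow> g v \<in> q \<Longrightarrow> D v \<noteq> 0 \<Longrightarrow>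
          p \<in> U' \<longleftrightarrow> q \<in> U"
        using zariski_open_pullback[where g = g, OF assms(1) U D(1) g] by blast
      have iff: "eY y' \<in> U' \<longleftrightarrow> \<psi> y' \<in> V" if "y' \<in> Y" "v \<in> eY y'" "D v \<noteq> 0" for y' v
      proof -
        obtain x where "x \<in> X" "g v \<in> eX x" "\<psi> y' = f x" using gf[OF \<open>y' \<in> Y\<close>] \<open>v \<in> eY y'\<close> \<open>D v \<noteq> 0\<close> by blast
        then show ?thesis using U'(3)[OF eY_ps eX_ps, of y' x v] that UV by simp
      qed
      show "\<exists>T. openin (topo (embedded J eY Y)) T \<and> y \<in> T \<and> T \<subseteq> {y \<in> Y. \<psi> y \<in> V}"
      proof (intro exI conjI)
        show "openin (topo (embedded J eY Y)) {y \<in> Y. eY y \<in> U'}"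
          unfolding openin_embedded using U'(1) by blast
        obtain v where "v \<in> eY y" using point[OF y(1)] by blast
        then show "y \<in> {y \<in> Y. eY y \<in> U'}" using iff[of y v] y D(2) by simp
        show "{y \<in> Y. eY y \<in> U'} \<subseteq> {y \<in> Y. \<psi> y \<in> V}"
        proof
          fix z assume "z \<in> {y \<in> Y. eY y \<in> U'}"
          then have z: "z \<in> Y" "eY z \<in> U'" by auto
          obtain v where v: "v \<in> eY z" using point[OF z(1)] by blast
          then show "z \<in> {y \<in> Y. \<psi> y \<in> V}" using iff[OF z(1) v U'(2)[OF z(2) v]] z by simp
        qed
      qed
    qed
  next
    fix V h assume V: "openin (topo Z) V \<and> h \<in> regular Z V"
    then have h: "h \<circ> f \<in> regular (embedded I eX X) {x \<in> X. f x \<in> V}"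
      using f unfolding morphism_def topX by blast
    show "h \<circ> \<psi> \<in> regular (embedded J eY Y) {y \<in> Y. \<psi> y \<in> V}"
      unfolding regular_embedded
    proof
      fix y assume "y \<in> {y \<in> Y. \<psi> y \<in> V}"
      then have y: "y \<in> Y" "\<psi> y \<in> V" by auto
      from lift[OF y(1)] obtain D g d e where D: "homogeneous J d D" "\<forall>v\<in>eY y. D v \<noteq> 0"
        and g: "\<And>i. i \<in> I \<Longrightarrow> homogeneous J e (\<lambda>v. g v i)"
        and gf: "\<And>y' v. y' \<in> Y \<Longrightarrow> v \<in> eY y' \<Longrightarrow> D v \<noteq> 0 \<Longrightarrow> \<exists>x\<in>X. g v \<in> eX x \<and> \<psi> y' = f x"
        by blast
      from point[OF y(1)] obtain v where v: "v \<in> eY y" by blast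
      obtain x where x: "x \<in> X" "g v \<in> eX x" "\<psi> y = f x" using gf[OF y(1) v] D(2) v by blast
      with y have "x \<in> {x \<in> X. f x \<in> V}" by auto
      from bspec[OF iffD1[OF regular_embedded h] this]
      obtain W c F G where W: "zariski_open I W" "eX x \<in> W"
        and FG: "homogeneous I c F" "homogeneous I c G"
        and FG_eq: "\<forall>x\<in>{x \<in> X. f x \<in> V}. eX x \<in> W \<longrightarrow>
           (\<forall>v\<in>eX x. G v \<noteq> 0 \<and> (h \<circ> f) x = F v / G v)"
        by (elim exE conjE)
      have eq: "G v \<noteq> 0 \<and> h (f x) = F v / G v"
        if "x \<in> X" "f x \<in> V" "eX x \<in> W" "v \<in> eX x" for x v
        using FG_eq that by simp
      obtain W' where W': "zariski_open J W'" "\<And>p v. p \<in> W' \<Longrightarrow> v \<in> p \<Longrightarrow> D v \<noteq> 0"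
        "\<And>p q v. p \<in> proj_space J \<Longrightarrow> q \<in> proj_space I \<Longrightarrow> v \<in> p \<Longrightarrow> g v \<in> q \<Longrightarrow> D v \<noteq> 0 \<Longrightarrow>
          p \<in> W' \<longleftrightarrow> q \<in> W"
        using zariski_open_pullback[where g = g, OF assms(1) W(1) D(1) g] by blast
      show "\<exists>W d F G. zariski_open J W \<and> eY y \<in> W \<and> homogeneous J d F \<and> homogeneous J d G \<and>
          (\<forall>y'\<in>{y \<in> Y. \<psi> y \<in> V}. eY y' \<in> W \<longrightarrow>
            (\<forall>v\<in>eY y'. G v \<noteq> 0 \<and> (h \<circ> \<psi>) y' = F v / G v))"
      \<comment> \<open>The fraction for \<psi> is the one for \<open>f\<close> with
        \<open>g\<close> substituted. Since all components of \<open>g\<close> have degree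
        \<open>e\<close>, numerator and denominator keep a common degree.\<close>
      proof (intro exI conjI ballI impI)
        show "zariski_open J W'" by fact
        show "eY y \<in> W'" 
          using W'(3)[OF eY_ps eX_ps, OF y(1) x(1) v x(2)] D(2) v W(2) by simp
        show "homogeneous J (c * e) (\<lambda>v. F (g v))"
          using homogeneous_subst[where g = g, OF FG(1) assms(1) g] .
        show "homogeneous J (c * e) (\<lambda>v. G (g v))"
          using homogeneous_subst[where g = g, OF FG(2) assms(1) g] .
        fix y' v assume y': "y' \<in> {y \<in> Y. \<psi> y \<in> V}" "eY y' \<in> W'" "v \<in> eY y'"
        then have nz: "D v \<noteq> 0" using W'(2) by blast
        obtain x where x: "x \<in> X" "g v \<in> eX x" "\<psi> y' = f x" using gf[of y' v] y' nz by blast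
        have "y' \<in> Y" using y' by simp
        from W'(3)[OF eY_ps eX_ps, OF this x(1) y'(3) x(2) nz] have "eX x \<in> W" using y'(2) by simp
        then have "G (g v) \<noteq> 0 \<and> h (f x) = F (g v) / G (g v)" using eq[of x "g v"] x y'(1) by simp
        then show "G (g v) \<noteq> 0" "(h \<circ> \<psi>) y' = F (g v) / G (g v)" using x by simp_all
      qed
    qed
  qed
qed


section \<open>Maximal minors\<close>

text \<open>Columns may come in any order and with repetitions, whereas the minors use increasing
  columns. This freedom is needed because Cramer's rule replaces one column in place.\<close>

definition select_cols :: "nat \<Rightarrow> real mat \<Rightarrow> (nat \<Rightarrow> nat) \<Rightarrow> real mat" where
  "select_cols k A f = mat k k (\<lambda>(i, j). A $$ (i, f j))"

lemma select_cols_carrier: "select_cols k A f \<in> carrier_mat k k"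
  unfolding select_cols_def by simp

lemma finite_pluecker_index: "finite (pluecker_index k N)"
  unfolding pluecker_index_def by simp

lemma pick_pluecker_index:
  assumes "J \<in> pluecker_index k N"
  shows "bij_betw (pick J) {..<k} J" "j < k \<Longrightarrow> pick J j < N"
proof -
  have J: "J \<subseteq> {..<N}" "card J = k" "finite J"
    using assms finite_subset unfolding pluecker_index_def by auto
  have mem: "pick J j \<in> J" if "j < k" for j
    using pick_in_set_le[of j J] that J by simp
  have lt: "pick J i < pick J j" if "i < j" "j < k" for i j
    using pick_mono_le[of j J i] that J by simp
  have "inj_on (pick J) {..<k}"
  proof (rule inj_onI)
    fix i j assume "i \<in> {..<k}" "j \<in> {..<k}" "pick J i = pick J j"
    then show "i = j" using lt[of i j] lt[of j i] by (cases i j rule: linorder_cases) auto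
  qed
  moreover have "pick J ` {..<k} = J"
  proof (rule card_subset_eq[OF J(3)])
    show "pick J ` {..<k} \<subseteq> J" using mem by auto
    show "card (pick J ` {..<k}) = card J" using card_image[OF \<open>inj_on _ _\<close>] J(2) by simp
  qed
  ultimately show "bij_betw (pick J) {..<k} J" unfolding bij_betw_def ..
  show "pick J j < N" if "j < k" using mem[OF that] J(1) by auto
qed

lemma minors_eq_det_select_cols:
  assumes "A \<in> carrier_mat k N" "J \<in> pluecker_index k N"
  shows "minors k N A J = det (select_cols k A (pick J))"
proof -
  have "{j. j < N \<and> j \<in> J} = J" "card J = k"
    using assms(2) unfolding pluecker_index_def by auto
  then have "submatrix A UNIV J = select_cols k A (pick J)"
    using assms(1) unfolding submatrix_def select_cols_def by (auto simp: pick_UNIV)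
  then show ?thesis using assms(2) unfolding minors_def by simp
qed

lemma minors_outside: "J \<notin> pluecker_index k N \<Longrightarrow> minors k N A J = 0"
  unfolding minors_def by simp

lemma det_permute_columns:
  assumes "B \<in> carrier_mat k k" "\<pi> permutes {0..<k}"
  shows "det (mat k k (\<lambda>(i, j). B $$ (i, \<pi> j))) = signof \<pi> * det (B :: real mat)"
proof -
  have "det (mat k k (\<lambda>(i, j). B $$ (i, \<pi> j))) = det (transpose_mat (mat k k (\<lambda>(i, j). B $$ (i, \<pi> j))))"
    by (rule det_transpose[OF mat_carrier, symmetric])
  also have "transpose_mat (mat k k (\<lambda>(i, j). B $$ (i, \<pi> j))) =
      mat k k (\<lambda>(i, j). transpose_mat B $$ (\<pi> i, j))"
    using assms permutes_in_image[OF assms(2)] by (intro eq_matI) auto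
  also have "det \<dots> = signof \<pi> * det (transpose_mat B)"
    by (rule det_permute_rows) (use assms in auto)
  finally show ?thesis using det_transpose[OF assms(1)] by simp
qed

text \<open>The point is the order of quantifiers: the sign depends on \<open>f\<close> alone and
  serves all matrices at once. A repeated column gives determinant and sign 0; otherwise sorting the
  columns contributes the sign of the sorting permutation.\<close>

lemma det_select_cols_eq_minor:
  assumes "\<And>j. j < k \<Longrightarrow> f j < N"
  shows "\<exists>\<epsilon>. (f ` {..<k} \<notin> pluecker_index k N \<longrightarrow> \<epsilon> = 0) \<and>
    (\<forall>A\<in>carrier_mat k N. det (select_cols k A f) = \<epsilon> * minors k N A (f ` {..<k}))"
proof (cases "inj_on f {..<k}")
  case False
  then obtain i j where ij: "i < k" "j < k" "i \<noteq> j" "f i = f j" unfolding inj_on_def by auto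
  have "det (select_cols k A f) = 0" for A
    by (rule det_identical_cols[OF select_cols_carrier ij(3,1,2)])
      (use ij in \<open>auto simp: select_cols_def col_def\<close>)
  then show ?thesis by (intro exI[of _ 0]) simp
next
  case True
  let ?J = "f ` {..<k}"
  have J: "?J \<in> pluecker_index k N"
    unfolding pluecker_index_def using assms card_image[OF True] by auto
  note pJ = pick_pluecker_index[OF J]
  \<comment> \<open>The position of \<open>f i\<close> in the increasing enumeration of the selected
    set, extended by the identity so that it is a permutation of all naturals.\<close>
  define \<pi> where "\<pi> i = (if i < k then inv_into {..<k} (pick ?J) (f i) else i)" for i
  have \<pi>_k: "\<pi> i < k" "pick ?J (\<pi> i) = f i" if "i < k" for i
    using that pJ(1) inv_into_into[of "f i" "pick ?J" "{..<k}"]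
      f_inv_into_f[of "f i" "pick ?J" "{..<k}"]
    unfolding \<pi>_def bij_betw_def by auto
  have "inj_on \<pi> {0..<k}"
  proof (rule inj_onI)
    fix i j assume "i \<in> {0..<k}" "j \<in> {0..<k}" "\<pi> i = \<pi> j"
    then show "i = j" using \<pi>_k(2)[of i] \<pi>_k(2)[of j] True unfolding inj_on_def by auto
  qed
  moreover have "\<pi> ` {0..<k} \<subseteq> {0..<k}" using \<pi>_k(1) by auto
  ultimately have "bij_betw \<pi> {0..<k} {0..<k}"
    by (simp add: bij_betw_def card_image card_subset_eq)
  then have perm: "\<pi> permutes {0..<k}"
    by (rule bij_imp_permutes) (simp add: \<pi>_def)
  have "det (select_cols k A f) = signof \<pi> * minors k N A ?J" if A: "A \<in> carrier_mat k N" for A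
  proof -
    have "select_cols k A f = mat k k (\<lambda>(i, j). select_cols k A (pick ?J) $$ (i, \<pi> j))"
      using \<pi>_k by (intro eq_matI) (auto simp: select_cols_def)
    then show ?thesis
      using det_permute_columns[OF select_cols_carrier perm] minors_eq_det_select_cols[OF A J]
      by simp
  qed
  then show ?thesis using J by (intro exI[of _ "signof \<pi>"]) auto
qed

lemma select_cols_mult:
  assumes "B \<in> carrier_mat k k" "A \<in> carrier_mat k N" "\<And>j. j < k \<Longrightarrow> f j < N"
  shows "select_cols k (B * A) f = B * select_cols k A f"
proof (rule eq_matI)
  fix i j assume "i < dim_row (B * select_cols k A f)" "j < dim_col (B * select_cols k A f)"
  then have ij: "i < k" "j < k" using assms(1) by (auto simp: select_cols_def)
  then have "col (select_cols k A f) j = col A (f j)"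
    using assms by (intro eq_vecI) (auto simp: select_cols_def)
  then show "select_cols k (B * A) f $$ (i, j) = (B * select_cols k A f) $$ (i, j)"
    using ij assms by (simp add: select_cols_def)
qed (use assms in \<open>auto simp: select_cols_def\<close>)

text \<open>The left factor is square, so selecting columns commutes with multiplying by it, and
  multiplicativity of the determinant suffices in place of Cauchy-Binet.\<close>

lemma minors_mult:
  assumes "B \<in> carrier_mat k k" "A \<in> carrier_mat k N"
  shows "minors k N (B * A) J = det B * minors k N A J"
proof (cases "J \<in> pluecker_index k N")
  case True
  have BA: "B * A \<in> carrier_mat k N" using assms by simp
  show ?thesis
    using minors_eq_det_select_cols[OF BA True] minors_eq_det_select_cols[OF assms(2) True]
      select_cols_mult[OF assms pick_pluecker_index(2)[OF True]] det_mult[OF assms(1) select_cols_carrier]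
    by simp
qed (simp add: minors_outside)

text \<open>In the Leibniz expansion every term is a product of \<open>k\<close> entries, each a
  form of degree \<open>e\<close>.\<close>

lemma homogeneous_det:
  assumes "\<And>i j. i < k \<Longrightarrow> j < k \<Longrightarrow> homogeneous I e (\<lambda>v. M v $$ (i, j))"
    and "\<And>v. M v \<in> carrier_mat k k"
  shows "homogeneous I (k * e) (\<lambda>v. det (M v))"
proof -
  have eq: "det (M v) = (\<Sum>p | p permutes {0..<k}. signof p * (\<Prod>i = 0..<k. M v $$ (i, p i)))" for v
    using det_def'[OF assms(2)] by simp
  have "homogeneous I (\<Sum>i\<in>{0..<k}. e) (\<lambda>v. \<Prod>i = 0..<k. M v $$ (i, p i))" if "p permutes {0..<k}" for p
    by (rule homogeneous_prod) (use assms(1) permutes_in_image[OF that] in auto)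
  then show ?thesis
    unfolding eq by (intro homogeneous_sum homogeneous_smult) simp
qed

lemma homogeneous_minors:
  assumes "\<And>i j. i < k \<Longrightarrow> j < N \<Longrightarrow> homogeneous I e (\<lambda>v. M v $$ (i, j))"
    and "\<And>v. M v \<in> carrier_mat k N"
  shows "homogeneous I (k * e) (\<lambda>v. minors k N (M v) J)"
proof (cases "J \<in> pluecker_index k N")
  case True
  have "homogeneous I (k * e) (\<lambda>v. det (select_cols k (M v) (pick J)))"
    by (rule homogeneous_det)
      (use assms(1) pick_pluecker_index(2)[OF True] in \<open>auto simp: select_cols_def\<close>)
  then show ?thesis using minors_eq_det_select_cols[OF assms(2) True] by simp
qed (simp add: minors_outside homogeneous.zero)


section \<open>Matrices with independent rows\<close>

text \<open>Triviality of the left kernel. The coefficients of a relation among the rows are a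
  vector \<open>c\<close>, to which the transposed matrix is applied.\<close>

definition row_indep :: "nat \<Rightarrow> nat \<Rightarrow> real mat \<Rightarrow> bool" where
  "row_indep k N A \<longleftrightarrow> (\<forall>c\<in>carrier_vec k. transpose_mat A *\<^sub>v c = 0\<^sub>v N \<longrightarrow> c = 0\<^sub>v k)"

lemma det_nonzero_inverse:
  assumes "A \<in> carrier_mat k k" "det (A :: real mat) \<noteq> 0"
  obtains B where "B \<in> carrier_mat k k" "A * B = 1\<^sub>m k" "B * A = 1\<^sub>m k"
  using det_non_zero_imp_unit[OF assms, of "()"] unfolding Units_def by (auto simp: ring_mat_simps)

lemma invertible_matI:
  assumes "A \<in> carrier_mat k k" "B \<in> carrier_mat k k" "A * B = 1\<^sub>m k" "B * A = 1\<^sub>m k"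
  shows "invertible_mat A"
  using assms unfolding invertible_mat_def inverts_mat_def by auto

lemma invertible_mat_det_nonzero:
  assumes "A \<in> carrier_mat k k" "det (A :: real mat) \<noteq> 0"
  shows "invertible_mat A"
  using det_nonzero_inverse[OF assms] invertible_matI[OF assms(1)] by metis

text \<open>A relation among the rows of \<open>A\<close> is also one among the rows of the square
  block of columns in \<open>J\<close>, and that block is invertible.\<close>

lemma minor_nonzero_imp_row_indep:
  assumes A: "A \<in> carrier_mat k N" and "minors k N A J \<noteq> 0"
  shows "row_indep k N A"
  unfolding row_indep_def
proof (intro ballI impI)
  fix c assume c: "c \<in> carrier_vec k" "transpose_mat A *\<^sub>v c = 0\<^sub>v N"
  have J: "J \<in> pluecker_index k N" using assms(2) minors_outside by blast
  let ?B = "transpose_mat (select_cols k A (pick J))"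
  have "?B *\<^sub>v c = 0\<^sub>v k"
  proof (rule eq_vecI)
    fix i assume "i < dim_vec (0\<^sub>v k :: real vec)"
    then have i: "i < k" by simp
    have "col (select_cols k A (pick J)) i = col A (pick J i)"
      using A i pick_pluecker_index(2)[OF J i] by (intro eq_vecI) (auto simp: select_cols_def)
    moreover have "(transpose_mat A *\<^sub>v c) $ pick J i = 0"
      using c(2) pick_pluecker_index(2)[OF J i] by simp
    ultimately show "(?B *\<^sub>v c) $ i = 0\<^sub>v k $ i"
      using i A pick_pluecker_index(2)[OF J i] by (simp add: select_cols_def)
  qed (simp add: select_cols_def)
  moreover have "det ?B \<noteq> 0"
    using assms(2) minors_eq_det_select_cols[OF A J] det_transpose[OF select_cols_carrier] by simp
  ultimately show "c = 0\<^sub>v k"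
    using det_0_iff_vec_prod_zero_field[of ?B k] c(1) select_cols_carrier by auto
qed

lemma row_indep_mult:
  assumes A: "A \<in> carrier_mat k N" and P: "P \<in> carrier_mat k k" and "Q \<in> carrier_mat k k"
    and QP: "P * Q = 1\<^sub>m k" and "row_indep k N A"
  shows "row_indep k N (P * A)"
  unfolding row_indep_def
proof (intro ballI impI)
  fix c assume c: "c \<in> carrier_vec k" "transpose_mat (P * A) *\<^sub>v c = 0\<^sub>v N"
  have "transpose_mat A *\<^sub>v (transpose_mat P *\<^sub>v c) = 0\<^sub>v N"
    using c transpose_mult[OF P A] A P by (simp add: assoc_mult_mat_vec[of _ N k _ k])
  then have "transpose_mat P *\<^sub>v c = 0\<^sub>v k"
    using assms(5) P c(1) unfolding row_indep_def by simp
  then have "transpose_mat Q *\<^sub>v (transpose_mat P *\<^sub>v c) = 0\<^sub>v k"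
    using \<open>Q \<in> carrier_mat k k\<close> by (intro eq_vecI) auto
  moreover have "transpose_mat Q * transpose_mat P = 1\<^sub>m k"
    using transpose_mult[OF P \<open>Q \<in> _\<close>] QP by simp
  ultimately show "c = 0\<^sub>v k"
    using assoc_mult_mat_vec[of "transpose_mat Q" k k "transpose_mat P" k c] P \<open>Q \<in> _\<close> c(1) by simp
qed

text \<open>The columns of the pivots in the reduced row echelon form give a nonzero minor.\<close>

lemma row_indep_imp_minor_nonzero:
  assumes A: "A \<in> carrier_mat k N" and indep: "row_indep k N A"
  shows "\<exists>J\<in>pluecker_index k N. minors k N A J \<noteq> 0"
proof -
  define C where "C = gauss_jordan_single A"
  note gj = gauss_jordan_single[OF A C_def[symmetric]]
  from gj(4) obtain P Q where P: "C = P * A" "P \<in> carrier_mat k k" "Q \<in> carrier_mat k k" "P * Q = 1\<^sub>m k"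
    by blast
  from gj(2,3) obtain f where f: "pivot_fun C f N" unfolding row_echelon_form_def by auto
  have C: "C \<in> carrier_mat k N" by (rule gj(2))
  note piv = pivot_funD[OF carrier_matD(1)[OF C] f]
  have C_indep: "row_indep k N C"
    unfolding P(1) by (rule row_indep_mult[OF A P(2-4) indep])
  \<comment> \<open>A pivot position \<open>N\<close> would mean a zero row, and then a unit vector
    would be a nontrivial relation among the rows.\<close>
  have f_lt: "f i < N" if i: "i < k" for i
  proof (rule ccontr)
    assume "\<not> f i < N"
    then have "row C i = 0\<^sub>v N" using piv(1)[OF i] pivot_fun_zero_row_iff[OF f C i] by simp
    have "C $$ (i, j) = 0" if "j < N" for j
    proof -
      have "C $$ (i, j) = row C i $ j" using that i C by simp
      then show ?thesis using \<open>row C i = 0\<^sub>v N\<close> that by simp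
    qed
    then have "transpose_mat C *\<^sub>v unit_vec k i = 0\<^sub>v N"
      using C i by (intro eq_vecI) auto
    then have "unit_vec k i = (0\<^sub>v k :: real vec)"
      using C_indep unfolding row_indep_def by simp
    then show False using i by simp
  qed
  have "select_cols k C f = 1\<^sub>m k"
    using piv(4,5) f_lt by (intro eq_matI) (auto simp: select_cols_def)
  moreover obtain \<epsilon> where "det (select_cols k C f) = \<epsilon> * minors k N C (f ` {..<k})"
    using det_select_cols_eq_minor[of k f N, OF f_lt] C by blast
  ultimately have nz: "minors k N A (f ` {..<k}) \<noteq> 0"
    using minors_mult[OF P(2) A] P(1) by auto
  then show ?thesis using minors_outside by blast
qed


lemma row_indep_iff_minor_nonzero:
  "A \<in> carrier_mat k N \<Longrightarrow> row_indep k N A \<longleftrightarrow> (\<exists>J\<in>pluecker_index k N. minors k N A J \<noteq> 0)"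
  using row_indep_imp_minor_nonzero minor_nonzero_imp_row_indep by blast


section \<open>Charts of the Pluecker coordinates\<close>

text \<open>One fixed choice of the sign that works for every matrix, so that it may multiply a
  coordinate \<open>p J\<close> of a vector \<open>p\<close> not known to consist of minors.\<close>

definition col_sign :: "nat \<Rightarrow> nat \<Rightarrow> (nat \<Rightarrow> nat) \<Rightarrow> real" where
  "col_sign k N f = (SOME \<epsilon>. (f ` {..<k} \<notin> pluecker_index k N \<longrightarrow> \<epsilon> = 0) \<and>
    (\<forall>A\<in>carrier_mat k N. det (select_cols k A f) = \<epsilon> * minors k N A (f ` {..<k})))"

lemma col_sign:
  assumes "\<And>j. j < k \<Longrightarrow> f j < N"
  shows "f ` {..<k} \<notin> pluecker_index k N \<Longrightarrow> col_sign k N f = 0"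
    and "A \<in> carrier_mat k N \<Longrightarrow> det (select_cols k A f) = col_sign k N f * minors k N A (f ` {..<k})"
  using someI_ex[OF det_select_cols_eq_minor[of k f N, OF assms]] unfolding col_sign_def by blast+

text \<open>On Pluecker coordinates \<open>p\<close> of a matrix \<open>A\<close> with \<open>p J \<noteq> 0\<close> this is, by Cramer's rule, \<open>p J\<close> times
  the matrix with the same row space whose columns in \<open>J\<close> form the identity matrix. It is linear
  in \<open>p\<close>.\<close>

definition chart :: "nat \<Rightarrow> nat \<Rightarrow> nat set \<Rightarrow> (nat set \<Rightarrow> real) \<Rightarrow> real mat" where
  "chart k N J p = mat k N (\<lambda>(i, j).
     col_sign k N ((pick J)(i := j)) * p ((pick J)(i := j) ` {..<k}))"

lemma chart_carrier: "chart k N J p \<in> carrier_mat k N"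
  unfolding chart_def by simp

text \<open>If the new column \<open>j\<close> repeats a column kept from \<open>J\<close>, the
  image is not a Pluecker index and \<open>p\<close> has no such homogeneous coordinate. The sign is
  0 in that case, so the entry is the zero form.\<close>

lemma homogeneous_chart:
  assumes "J \<in> pluecker_index k N" "i < k" "j < N"
  shows "homogeneous (pluecker_index k N) 1 (\<lambda>p. chart k N J p $$ (i, j))"
proof -
  let ?f = "(pick J)(i := j)"
  have f: "?f l < N" if "l < k" for l
    using that assms(3) pick_pluecker_index(2)[OF assms(1)] by simp
  have "homogeneous (pluecker_index k N) 1 (\<lambda>p. col_sign k N ?f * p (?f ` {..<k}))"
  proof (cases "?f ` {..<k} \<in> pluecker_index k N")
    case True
    then show ?thesis by (rule homogeneous_smult[OF homogeneous_coord[OF finite_pluecker_index]])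
  next
    case False
    with col_sign(1)[of k ?f N, OF f] show ?thesis by (simp add: homogeneous.zero)
  qed
  then show ?thesis unfolding chart_def using assms(2,3) by simp
qed

text \<open>The factor \<open>g\<close> is the adjugate of the block \<open>AJ\<close> of columns in
  \<open>J\<close>, written as \<open>det AJ\<close> times its inverse \<open>B\<close>. The vector
  \<open>B *\<^sub>v col A j\<close> solves the linear system with matrix \<open>AJ\<close> and
  right-hand side column \<open>j\<close> of \<open>A\<close>, and Cramer's rule expresses its
  entries by the determinants of \<open>AJ\<close> with column \<open>i\<close> replaced, which are
  the signed minors in the chart. Its determinant is the minor to the power \<open>k - 1\<close>;
  the statement multiplies by the minor to avoid the subtraction.\<close>

lemma chart_minors:
  assumes A: "A \<in> carrier_mat k N" and J: "J \<in> pluecker_index k N"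
    and nz: "minors k N A J \<noteq> 0"
  obtains g where "g \<in> carrier_mat k k" "det g \<noteq> 0" "chart k N J (minors k N A) = g * A"
    "det g * minors k N A J = minors k N A J ^ k"
proof -
  define AJ where "AJ = select_cols k A (pick J)"
  have AJ: "AJ \<in> carrier_mat k k" unfolding AJ_def by (rule select_cols_carrier)
  have det: "det AJ = minors k N A J" unfolding AJ_def by (rule minors_eq_det_select_cols[OF A J, symmetric])
  with nz obtain B where B: "B \<in> carrier_mat k k" "AJ * B = 1\<^sub>m k" "B * AJ = 1\<^sub>m k"
    using det_nonzero_inverse[OF AJ] by metis
  define g where "g = det AJ \<cdot>\<^sub>m B"
  have g: "g \<in> carrier_mat k k" unfolding g_def using B by simp
  have "det AJ * det B = 1" using det_mult[OF AJ B(1)] B(2) by simp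
  then have "det g * det AJ = det AJ ^ k" unfolding g_def using B(1) by (simp add: mult.assoc mult.commute)
  moreover have "chart k N J (minors k N A) = g * A"
  proof (rule eq_matI)
    fix i j assume "i < dim_row (g * A)" "j < dim_col (g * A)"
    then have ij: "i < k" "j < N" using g A by auto
    let ?f = "(pick J)(i := j)"
    let ?x = "B *\<^sub>v col A j"
    have x: "?x \<in> carrier_vec k" using mult_mat_vec_carrier[OF B(1)] A by auto
    have "AJ *\<^sub>v ?x = (AJ * B) *\<^sub>v col A j"
      using assoc_mult_mat_vec[OF AJ B(1), of "col A j"] A ij by simp
    then have "AJ *\<^sub>v ?x = col A j" using B(2) A ij by simp
    moreover have "replace_col AJ (col A j) i = select_cols k A ?f"
      using A ij unfolding replace_col_def select_cols_def AJ_def by (intro eq_matI) auto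
    ultimately have "det (select_cols k A ?f) = ?x $ i * det AJ"
      using cramer_lemma_mat[OF AJ x ij(1)] by simp
    moreover have "det (select_cols k A ?f) = col_sign k N ?f * minors k N A (?f ` {..<k})"
      by (rule col_sign(2)[OF _ A]) (use ij pick_pluecker_index(2)[OF J] in simp)
    ultimately show "chart k N J (minors k N A) $$ (i, j) = (g * A) $$ (i, j)"
      using ij A B(1) unfolding chart_def g_def by (simp add: mult.commute)
  qed (use g A in \<open>auto simp: chart_def\<close>)
  moreover have "det g \<noteq> 0" using \<open>det g * det AJ = det AJ ^ k\<close> nz det by auto
  ultimately show ?thesis using that[OF g] det by simp
qed

text \<open>A polynomial identity, valid also where the minor at \<open>J\<close> vanishes. Read
  with \<open>p\<close> in place of the minors of \<open>A\<close>, these are the equations for the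
  Grassmannian.\<close>

lemma chart_minors_relation:
  assumes "A \<in> carrier_mat k N" "J \<in> pluecker_index k N"
  shows "minors k N A J * minors k N (chart k N J (minors k N A)) J' =
    minors k N A J ^ k * minors k N A J'"
proof (cases "minors k N A J = 0")
  case True
  show ?thesis
  proof (cases "k = 0")
    \<comment> \<open>Here the power with exponent 0 would be 1 rather than 0, but the only index is
      empty and its minor is the empty determinant 1, so a vanishing minor is impossible.\<close>
    case k: True
    then have "J = {}" using assms(2) unfolding pluecker_index_def by (auto simp: finite_subset)
    with k True assms show ?thesis
      by (simp add: minors_eq_det_select_cols select_cols_def)
  qed (use True in simp)
next
  case False
  from chart_minors[OF assms False] obtain g where g: "g \<in> carrier_mat k k"
    "chart k N J (minors k N A) = g * A" "det g * minors k N A J = minors k N A J ^ k" by metis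
  show ?thesis
    unfolding g(2) minors_mult[OF g(1) assms(1)] g(3)[symmetric] by simp
qed


section \<open>Row spaces\<close>

lemma row_space_eq_image:
  assumes "(A :: real mat) \<in> carrier_mat k N"
  shows "vec_space.row_space N A = (\<lambda>c. transpose_mat A *\<^sub>v c) ` carrier_vec k"
proof -
  interpret vec_space "TYPE(real)" N .
  show ?thesis using row_space_eq[OF assms] assms by auto
qed

lemma row_in_row_space:
  assumes "(A :: real mat) \<in> carrier_mat k N" "i < k"
  shows "row A i \<in> vec_space.row_space N A"
proof -
  have "row A i = transpose_mat A *\<^sub>v unit_vec k i"
    using assms by (intro eq_vecI) auto
  then show ?thesis unfolding row_space_eq_image[OF assms(1)] by auto
qed

text \<open>The rows of \<open>g\<close> are coefficient vectors that express the rows of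
  \<open>A\<close> through those of \<open>B\<close>.\<close>

lemma row_space_subset_factor:
  assumes A: "(A :: real mat) \<in> carrier_mat k N" and B: "B \<in> carrier_mat k N"
    and "vec_space.row_space N A \<subseteq> vec_space.row_space N B"
  obtains g where "g \<in> carrier_mat k k" "A = g * B"
proof -
  have "\<exists>c\<in>carrier_vec k. row A i = transpose_mat B *\<^sub>v c" if "i < k" for i
    using row_in_row_space[OF A that] assms(3) unfolding row_space_eq_image[OF B] by auto
  then obtain c where c: "\<And>i. i < k \<Longrightarrow> c i \<in> carrier_vec k"
    "\<And>i. i < k \<Longrightarrow> row A i = transpose_mat B *\<^sub>v c i" by metis
  define g where "g = mat k k (\<lambda>(i, j). c i $ j)"
  have "A = g * B"
  proof (rule eq_matI)
    fix i j assume "i < dim_row (g * B)" "j < dim_col (g * B)"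
    then have ij: "i < k" "j < N" using B by (auto simp: g_def)
    have "row g i = c i" using ij c(1)[OF ij(1)] by (intro eq_vecI) (auto simp: g_def)
    moreover have "A $$ (i, j) = row A i $ j" using A ij by simp
    ultimately show "A $$ (i, j) = (g * B) $$ (i, j)"
      using c(1)[OF ij(1)] c(2)[OF ij(1)] B ij
      by (simp add: g_def comm_scalar_prod[of _ k])
  qed (use A B in \<open>auto simp: g_def\<close>)
  then show ?thesis using that[of g] by (simp add: g_def)
qed

lemma row_space_mult:
  assumes "(A :: real mat) \<in> carrier_mat k N" "g \<in> carrier_mat k k" "det g \<noteq> 0"
  shows "vec_space.row_space N (g * A) = vec_space.row_space N A"
proof -
  interpret vec_space "TYPE(real)" N .
  show ?thesis
    by (rule row_space_is_preserved[OF invertible_mat_det_nonzero[OF assms(2,3)] assms(2,1)])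
qed

text \<open>Invertibility of the factor is read off from the minors: a nonzero minor of
  \<open>A\<close> is \<open>det g\<close> times a minor of \<open>B\<close>.\<close>

lemma row_space_eq_factor:
  assumes A: "A \<in> carrier_mat k N" and B: "B \<in> carrier_mat k N"
    and "vec_space.row_space N A = vec_space.row_space N B" and "row_indep k N A"
  obtains g where "g \<in> carrier_mat k k" "det g \<noteq> 0" "A = g * B"
proof -
  obtain g where g: "g \<in> carrier_mat k k" "A = g * B"
    using row_space_subset_factor[OF A B] assms(3) by blast
  obtain J where "minors k N A J \<noteq> 0" using row_indep_imp_minor_nonzero[OF A assms(4)] by blast
  then have "det g \<noteq> 0" using minors_mult[OF g(1) B] g(2) by auto
  with g that show ?thesis by blast
qed

text \<open>The dimension is the rank of the transpose, computed from the set of its columns, which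
  forgets repetitions. Relations refer to the list of rows, so in both directions distinctness has
  to be settled separately.\<close>

lemma subspace_dim_row_space_iff:
  assumes A: "A \<in> carrier_mat k N"
  shows "subspace_dim N (vec_space.row_space N A) = k \<longleftrightarrow> row_indep k N A"
proof -
  interpret vec_space "TYPE(real)" N .
  let ?B = "transpose_mat A"
  have B: "?B \<in> carrier_mat N k" using A by simp
  have dim: "subspace_dim N (row_space A) = rank ?B"
    unfolding subspace_dim_def rank_def row_space_def by simp
  have len: "length (cols ?B) = k" using A by simp
  show ?thesis
  proof
    assume "subspace_dim N (row_space A) = k"
    with dim have rank: "rank ?B = k" by simp
    obtain S where S: "maximal S (\<lambda>T. T \<subseteq> set (cols ?B) \<and> lin_indpt T)"
      using maximal_exists_superset[of "set (cols ?B)" "\<lambda>T. T \<subseteq> set (cols ?B) \<and> lin_indpt T" "{}"]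
      by (auto simp: lin_dep_def)
    have "card S = k" using rank_card_indpt[OF B S] rank by simp
    moreover have "card S \<le> card (set (cols ?B))"
      using S unfolding maximal_def by (intro card_mono) auto
    \<comment> \<open>An independent set of \<open>k\<close> columns inside a list of length
      \<open>k\<close> leaves no room for a repetition.\<close>
    ultimately have "card (set (cols ?B)) = length (cols ?B)"
      using len card_length[of "cols ?B"] by simp
    then have "distinct (cols ?B)" by (rule card_distinct)
    then show "row_indep k N A"
      unfolding row_indep_def using full_rank_lin_indpt[OF B rank] lin_depI[OF B] by blast
  next
    assume indep: "row_indep k N A"
    have "distinct (cols ?B)"
    proof (rule ccontr)
      assume "\<not> distinct (cols ?B)"
      then obtain i j where ij: "i < k" "j < k" "i \<noteq> j" "col ?B i = col ?B j"
        unfolding distinct_conv_nth using A by auto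
      \<comment> \<open>Two equal rows are related by the difference of the corresponding unit
        vectors.\<close>
      let ?c = "unit_vec k i - unit_vec k j :: real vec"
      have "?B *\<^sub>v ?c = 0\<^sub>v N"
      proof (rule eq_vecI)
        fix l assume "l < dim_vec (0\<^sub>v N :: real vec)"
        then have l: "l < N" by simp
        have "A $$ (i, l) = col ?B i $ l" using A ij(1) l by simp
        also have "\<dots> = A $$ (j, l)" unfolding ij(4) using A ij l by simp
        finally show "(?B *\<^sub>v ?c) $ l = 0\<^sub>v N $ l"
          using A ij l by (simp add: scalar_prod_minus_distrib[of _ k])
      qed (use A in simp)
      then have "?c = 0\<^sub>v k" using indep unfolding row_indep_def by simp
      then have "?c $ i = 0" using ij by simp
      then show False using ij by simp
    qed
    moreover have "lin_indpt (set (cols ?B))"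
    proof
      assume "lin_dep (set (cols ?B))"
      from lin_depE[OF B this \<open>distinct (cols ?B)\<close>] indep show False
        unfolding row_indep_def by blast
    qed
    ultimately show "subspace_dim N (row_space A) = k"
      using dim lin_indpt_full_rank[OF B] by simp
  qed
qed

text \<open>Turns statements about subspaces into statements about matrices: a basis, listed as
  rows, represents the subspace, and independence of the rows records its dimension.\<close>

lemma Grass_eq:
  "Grass k N = {vec_space.row_space N A | A. A \<in> carrier_mat k N \<and> row_indep k N A}"
proof (intro equalityI subsetI)
  interpret vec_space "TYPE(real)" N .
  fix W assume "W \<in> Grass k N"
  then have W: "subspace class_ring W V" and dim: "subspace_dim N W = k"
    unfolding Grass_def by auto
  interpret W: vectorspace class_ring "vs W" by (rule subspace_is_vs[OF W])
  have sub: "submodule class_ring W V" using W unfolding subspace_def by simp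
  have W_carrier: "W \<subseteq> carrier_vec N" using sub unfolding LinearCombinations.submodule_def by simp
  \<comment> \<open>Independence inside \<open>W\<close> is independence in the ambient space, so
    \<open>N\<close> bounds the size. This makes a maximal independent set, hence a finite basis,
    exist.\<close>
  have bound: "finite S \<and> card S \<le> N" if "S \<subseteq> carrier (vs W) \<and> W.lin_indpt S" for S
  proof -
    from that have S: "S \<subseteq> W" "lin_indpt S" using span_li_not_depend(2)[OF _ sub] by auto
    show ?thesis using li_le_dim[OF fin_dim _ S(2)] S(1) W_carrier dim_is_n by auto
  qed
  have empty: "{} \<subseteq> carrier (vs W) \<and> W.lin_indpt {}" unfolding W.lin_dep_def by simp
  obtain U where U: "finite U" "maximal U (\<lambda>S. S \<subseteq> carrier (vs W) \<and> W.lin_indpt S)"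
    using maximal_exists[of "\<lambda>S. S \<subseteq> carrier (vs W) \<and> W.lin_indpt S", OF bound empty] by blast
  have basis: "W.basis U" by (rule W.max_li_is_basis[OF U(2)])
  have "card U = k" using W.dim_basis[OF U(1) basis] dim unfolding subspace_dim_def by simp
  obtain us where us: "set us = U" "length us = k"
    using finite_distinct_list[OF U(1)] distinct_card \<open>card U = k\<close> by metis
  have UW: "U \<subseteq> W" using basis unfolding W.basis_def by simp
  have "span U = W"
    using basis span_li_not_depend(1)[OF UW sub] unfolding W.basis_def by simp
  define A where "A = mat_of_rows N us"
  have A: "A \<in> carrier_mat k N" unfolding A_def us(2)[symmetric] by simp
  have "set (rows A) = U"
    using rows_mat_of_rows[of us N] us UW W_carrier unfolding A_def by auto
  then have "row_space A = W" using \<open>span U = W\<close> unfolding row_space_def by simp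
  moreover from this dim have "row_indep k N A" using subspace_dim_row_space_iff[OF A] by simp
  ultimately show "W \<in> {row_space A | A. A \<in> carrier_mat k N \<and> row_indep k N A}" using A by blast
next
  interpret vec_space "TYPE(real)" N .
  fix W assume "W \<in> {row_space A | A. A \<in> carrier_mat k N \<and> row_indep k N A}"
  then obtain A where A: "W = row_space A" "A \<in> carrier_mat k N" "row_indep k N A" by blast
  have "set (rows A) \<subseteq> carrier V" using A(2) unfolding rows_def by auto
  then have "subspace class_ring W V"
    unfolding A(1) row_space_def by (intro span_is_subspace) simp_all
  then show "W \<in> Grass k N"
    using subspace_dim_row_space_iff[OF A(2)] A unfolding Grass_def by simp
qed


section \<open>The Pluecker embedding\<close>

lemma pluecker_row_space:
  assumes A: "A \<in> carrier_mat k N" and indep: "row_indep k N A" and "k > 0"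
  shows "pluecker k N (vec_space.row_space N A) = proj_point (minors k N A)"
proof (intro equalityI subsetI)
  fix p assume "p \<in> pluecker k N (vec_space.row_space N A)"
  then obtain B where B: "B \<in> carrier_mat k N" "p = minors k N B"
    and "vec_space.row_space N B = vec_space.row_space N A" unfolding pluecker_def by blast
  note eq = this(3)[symmetric]
  obtain g where g: "g \<in> carrier_mat k k" "det g \<noteq> 0" "A = g * B"
    using row_space_eq_factor[OF A B(1) eq indep] .
  have "minors k N A J = det g * p J" for J
    unfolding g(3) B(2) by (rule minors_mult[OF g(1) B(1)])
  then have "p = (\<lambda>J. inverse (det g) * minors k N A J)"
    using g(2) by (simp add: fun_eq_iff)
  then show "p \<in> proj_point (minors k N A)"
    unfolding proj_point_def using g(2) by (intro CollectI exI[of _ "inverse (det g)"]) simp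
next
  fix p assume "p \<in> proj_point (minors k N A)"
  then obtain c where c: "c \<noteq> 0" "p = (\<lambda>J. c * minors k N A J)" unfolding proj_point_def by blast
  \<comment> \<open>Scaling one row by \<open>c\<close> has determinant exactly \<open>c\<close>. A
    scalar matrix would give only \<open>k\<close>-th powers, which over the reals miss the negative
    numbers for even \<open>k\<close>. Row 0 exists because \<open>k > 0\<close>.\<close>
  let ?g = "multrow_mat k 0 c"
  have g: "?g \<in> carrier_mat k k" "det ?g = c" using det_multrow_mat[of 0 k c] assms(3) by auto
  have "p = minors k N (?g * A)"
    unfolding c(2) using minors_mult[OF g(1) A] g(2) by (simp add: fun_eq_iff)
  moreover have "vec_space.row_space N (?g * A) = vec_space.row_space N A"
    by (rule row_space_mult[OF A g(1)]) (use g(2) c(1) in simp)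
  ultimately show "p \<in> pluecker k N (vec_space.row_space N A)"
    unfolding pluecker_def using mult_carrier_mat[OF g(1) A] by (intro CollectI exI[of _ "?g * A"]) simp
qed

lemma pluecker_in_proj_space:
  assumes "k > 0"
  shows "pluecker k N ` Grass k N \<subseteq> proj_space (pluecker_index k N)"
proof
  fix p assume "p \<in> pluecker k N ` Grass k N"
  then obtain A where A: "A \<in> carrier_mat k N" "row_indep k N A"
    and p: "p = pluecker k N (vec_space.row_space N A)" unfolding Grass_eq by auto
  from row_indep_imp_minor_nonzero[OF A] obtain J where "minors k N A J \<noteq> 0" by blast
  then show "p \<in> proj_space (pluecker_index k N)"
    unfolding p pluecker_row_space[OF A assms]
    by (rule proj_point_in_proj_space[rotated]) (rule minors_outside)
qed

lemma pluecker_memberE: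
  assumes "p \<in> pluecker k N W" "W \<in> Grass k N"
  obtains A where "A \<in> carrier_mat k N" "row_indep k N A" "p = minors k N A"
    "W = vec_space.row_space N A"
proof -
  from assms(1) obtain A where A: "A \<in> carrier_mat k N" "p = minors k N A"
    "W = vec_space.row_space N A" unfolding pluecker_def by auto
  then have "row_indep k N A"
    using assms(2) subspace_dim_row_space_iff[OF A(1)] unfolding Grass_def by simp
  with A that show ?thesis by blast
qed

text \<open>The chart at \<open>p\<close> is an invertible multiple of any matrix whose minors are
  \<open>p\<close>. Thus on the locus \<open>p J \<noteq> 0\<close> it is a section of the passage
  from matrices to row spaces.\<close>

lemma chart_of_pluecker:
  assumes "W \<in> Grass k N" "p \<in> pluecker k N W" "J \<in> pluecker_index k N" "p J \<noteq> 0"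
  shows "vec_space.row_space N (chart k N J p) = W" "row_indep k N (chart k N J p)"
proof -
  obtain A where A: "A \<in> carrier_mat k N" "row_indep k N A" "p = minors k N A"
    "W = vec_space.row_space N A" using pluecker_memberE[OF assms(2,1)] .
  have nz: "minors k N A J \<noteq> 0" using assms(4) A(3) by simp
  obtain g where g: "g \<in> carrier_mat k k" "det g \<noteq> 0" "chart k N J p = g * A"
    using chart_minors[OF A(1) assms(3) nz] A(3) by metis
  show "vec_space.row_space N (chart k N J p) = W"
    unfolding g(3) A(4) by (rule row_space_mult[OF A(1) g(1,2)])
  have "minors k N (chart k N J p) J \<noteq> 0"
    unfolding g(3) minors_mult[OF g(1) A(1)] using g(2) nz by simp
  then show "row_indep k N (chart k N J p)"
    by (rule minor_nonzero_imp_row_indep[OF chart_carrier])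
qed

lemma pluecker_nonzero_coordinate:
  assumes "W \<in> Grass k N" "p \<in> pluecker k N W"
  shows "\<exists>J\<in>pluecker_index k N. p J \<noteq> 0"
proof -
  obtain A where "A \<in> carrier_mat k N" "row_indep k N A" "p = minors k N A"
    using pluecker_memberE[OF assms(2,1)] .
  then show ?thesis using row_indep_imp_minor_nonzero by simp
qed

text \<open>A single coordinate vector of the Pluecker point already determines the subspace, as the
  row space of its chart at a nonzero coordinate.\<close>

lemma inj_on_pluecker:
  assumes "k > 0"
  shows "inj_on (pluecker k N) (Grass k N)"
proof (rule inj_onI)
  fix W W' assume W: "W \<in> Grass k N" "W' \<in> Grass k N" "pluecker k N W = pluecker k N W'"
  have "pluecker k N W \<in> proj_space (pluecker_index k N)"
    using pluecker_in_proj_space[OF assms] W(1) by blast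
  then obtain p where p: "p \<in> pluecker k N W" using proj_space_nonempty by blast
  obtain J where J: "J \<in> pluecker_index k N" "p J \<noteq> 0"
    using pluecker_nonzero_coordinate[OF W(1) p] by blast
  have "W = vec_space.row_space N (chart k N J p)"
    by (rule chart_of_pluecker(1)[OF W(1) p J, symmetric])
  also have "\<dots> = W'" by (rule chart_of_pluecker(1)[OF W(2) p[unfolded W(3)] J])
  finally show "W = W'" .
qed

text \<open>The equations are imposed for all \<open>J\<close> at once, since the nonzero coordinate
  varies with the point. Both terms have degree \<open>k + 1\<close>, one factor \<open>p J\<close>
  being carried along on each side.\<close>

lemma closedin_pluecker_image:
  assumes "k > 0"
  shows "closedin (zariski (pluecker_index k N)) (pluecker k N ` Grass k N)"
proof -
  let ?I = "pluecker_index k N"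
  let ?F = "\<lambda>J J' p. p J * minors k N (chart k N J p) J' - p J ^ k * p J'"
  let ?\<F> = "{?F J J' | J J'. J \<in> ?I \<and> J' \<in> ?I}"
  show ?thesis
  proof (rule closedin_zariski_zero_locus[of ?\<F>])
    show "\<exists>d. homogeneous ?I d F" if F: "F \<in> ?\<F>" for F
    proof -
      from F obtain J J' where J: "F = ?F J J'" "J \<in> ?I" "J' \<in> ?I" by blast
      have coord: "homogeneous ?I 1 (\<lambda>p. p J)" "homogeneous ?I 1 (\<lambda>p. p J')"
        by (rule homogeneous_coord[OF finite_pluecker_index J(2)],
          rule homogeneous_coord[OF finite_pluecker_index J(3)])
      have "homogeneous ?I (k * 1) (\<lambda>p. minors k N (chart k N J p) J')"
        by (rule homogeneous_minors[OF homogeneous_chart[OF J(2)] chart_carrier])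
      from homogeneous_mult[OF coord(1) this]
      have "homogeneous ?I (k + 1) (\<lambda>p. p J * minors k N (chart k N J p) J')" by simp
      moreover have "homogeneous ?I (k * 1 + 1) (\<lambda>p. p J ^ k * p J')"
        by (rule homogeneous_mult[OF homogeneous_power[OF coord(1)] coord(2)])
      ultimately have "homogeneous ?I (k + 1) (?F J J')"
        using homogeneous_diff by simp
      then show ?thesis unfolding J(1) by (rule exI)
    qed
    show "pluecker k N ` Grass k N \<subseteq> proj_space ?I" by (rule pluecker_in_proj_space[OF assms])
    fix q v assume q: "q \<in> proj_space ?I" "v \<in> q"
    note vq = proj_spaceD[OF q]
    show "q \<in> pluecker k N ` Grass k N \<longleftrightarrow> (\<forall>F\<in>?\<F>. F v = 0)"
    proof
      assume "q \<in> pluecker k N ` Grass k N"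
      then obtain W where W: "W \<in> Grass k N" "v \<in> pluecker k N W" using q(2) by blast
      obtain A where A: "A \<in> carrier_mat k N" "v = minors k N A"
        using pluecker_memberE[OF W(2,1)] by metis
      have "?F J J' v = 0" if "J \<in> ?I" for J J'
        using chart_minors_relation[OF A(1) that, of J'] unfolding A(2) by simp
      then show "\<forall>F\<in>?\<F>. F v = 0" by auto
    next
      assume zero: "\<forall>F\<in>?\<F>. F v = 0"
      obtain J where J: "v J \<noteq> 0" using vq(3) by blast
      then have "J \<in> ?I" using vq(2) by blast
      define A where "A = chart k N J v"
      have A: "A \<in> carrier_mat k N" unfolding A_def by (rule chart_carrier)
      have rel: "v J * minors k N A J' = v J ^ k * v J'" for J'
      proof (cases "J' \<in> ?I")
        case True
        with \<open>J \<in> ?I\<close> have "?F J J' \<in> ?\<F>" by blast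
        with zero have "?F J J' v = 0" by (rule bspec)
        then show ?thesis unfolding A_def by simp
      qed (use vq(2) in \<open>simp add: minors_outside\<close>)
      \<comment> \<open>The quotient is \<open>v J\<close> to the power \<open>k - 1\<close>, hence
        nonzero: the minors of the chart and \<open>v\<close> represent the same projective
        point.\<close>
      have m: "minors k N A = (\<lambda>J'. (v J ^ k / v J) * v J')"
        using rel J by (intro ext) (simp add: field_simps)
      then have "minors k N A J \<noteq> 0" using J by simp
      then have indep: "row_indep k N A" by (rule minor_nonzero_imp_row_indep[OF A])
      have "pluecker k N (vec_space.row_space N A) = q"
        unfolding pluecker_row_space[OF A indep assms] m vq(1)
        by (rule proj_point_scale) (use J in simp)
      moreover have "vec_space.row_space N A \<in> Grass k N" unfolding Grass_eq using A indep by blast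
      ultimately show "q \<in> pluecker k N ` Grass k N" by blast
    qed
  qed
qed

section \<open>Irreducibility of the Grassmannian through its parametrisation by matrices\<close>

definition coord_mat :: "nat \<Rightarrow> nat \<Rightarrow> (nat \<Rightarrow> real) \<Rightarrow> real mat" where
  "coord_mat k N v = mat k N (\<lambda>(i, j). v (i * N + j))"

lemma coord_mat_carrier: "coord_mat k N v \<in> carrier_mat k N"
  unfolding coord_mat_def by simp

lemma mat_index_less: "i < k \<Longrightarrow> j < N \<Longrightarrow> i * N + j < k * (N :: nat)"
  using mult_le_mono1[of "Suc i" k N] by simp

lemma homogeneous_coord_mat:
  assumes "i < k" "j < N"
  shows "homogeneous {..<k * N} 1 (\<lambda>v. coord_mat k N v $$ (i, j))"
  using homogeneous_coord[of "{..<k * N}" "i * N + j"] assms mat_index_less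
  unfolding coord_mat_def by simp

lemma coord_mat_surj:
  assumes "A \<in> carrier_mat k N"
  shows "coord_mat k N (\<lambda>l. A $$ (l div N, l mod N)) = A"
  using assms unfolding coord_mat_def by (intro eq_matI) auto

lemma Grass_nonempty:
  assumes "k \<le> N"
  shows "Grass k N \<noteq> {}"
proof -
  define A :: "real mat" where "A = mat k N (\<lambda>(i, j). if i = j then 1 else 0)"
  have A: "A \<in> carrier_mat k N" unfolding A_def by simp
  have lt: "id j < N" if "j < k" for j using that assms by simp
  have "select_cols k A id = 1\<^sub>m k"
    using assms unfolding select_cols_def A_def by (intro eq_matI) auto
  with col_sign(2)[of k id N, OF lt A] have "minors k N A (id ` {..<k}) \<noteq> 0" by auto
  then have "row_indep k N A" by (rule minor_nonzero_imp_row_indep[OF A])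
  then show ?thesis unfolding Grass_eq using A by blast
qed

text \<open>All matrices parametrise the image by their minors. The condition \<open>D\<close> at a
  point is one of its nonzero minors, which keeps the rows independent and thereby the parametrised
  vector on the image. The bound on \<open>k\<close> provides the point that irreducibility
  demands.\<close>

lemma projective_variety_Grass:
  assumes "k > 0" "k \<le> N"
  shows "projective_variety (pluecker_index k N) (pluecker k N) (Grass k N)"
proof -
  let ?I = "pluecker_index k N"
  let ?S = "pluecker k N ` Grass k N"
  have "irreducible_in (zariski ?I) ?S"
  proof (rule irreducible_in_zariskiI[where g = "\<lambda>v. minors k N (coord_mat k N v)"])
    show "?S \<noteq> {}" using Grass_nonempty[OF assms(2)] by simp
    show "?S \<subseteq> proj_space ?I" by (rule pluecker_in_proj_space[OF assms(1)])
    have hom: "homogeneous {..<k * N} (k * 1) (\<lambda>v. minors k N (coord_mat k N v) J)" for J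
      by (rule homogeneous_minors[OF homogeneous_coord_mat coord_mat_carrier])
    then show "homogeneous {..<k * N} (k * 1) (\<lambda>v. minors k N (coord_mat k N v) J)" for J .
    fix p assume "p \<in> ?S"
    then obtain A where A: "A \<in> carrier_mat k N" "row_indep k N A"
      and p: "p = pluecker k N (vec_space.row_space N A)" unfolding Grass_eq by blast
    obtain J where J: "minors k N A J \<noteq> 0" using row_indep_imp_minor_nonzero[OF A] by blast
    let ?a = "\<lambda>l. A $$ (l div N, l mod N)"
    show "\<exists>D d a. homogeneous {..<k * N} d D \<and> D a \<noteq> 0 \<and> minors k N (coord_mat k N a) \<in> p \<and>
      (\<forall>b. D b \<noteq> 0 \<longrightarrow> (\<exists>q\<in>?S. minors k N (coord_mat k N b) \<in> q))"
    proof (intro exI conjI allI impI)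
      show "homogeneous {..<k * N} (k * 1) (\<lambda>v. minors k N (coord_mat k N v) J)" by (rule hom)
      show "minors k N (coord_mat k N ?a) J \<noteq> 0" unfolding coord_mat_surj[OF A(1)] by (rule J)
      show "minors k N (coord_mat k N ?a) \<in> p"
        unfolding coord_mat_surj[OF A(1)] p pluecker_row_space[OF A assms(1)] by (rule proj_point_self)
      fix b assume "minors k N (coord_mat k N b) J \<noteq> 0"
      then have indep: "row_indep k N (coord_mat k N b)"
        by (rule minor_nonzero_imp_row_indep[OF coord_mat_carrier])
      show "\<exists>q\<in>?S. minors k N (coord_mat k N b) \<in> q"
      proof (rule bexI)
        show "minors k N (coord_mat k N b) \<in> pluecker k N (vec_space.row_space N (coord_mat k N b))"
          unfolding pluecker_row_space[OF coord_mat_carrier indep assms(1)] by (rule proj_point_self)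
        show "pluecker k N (vec_space.row_space N (coord_mat k N b)) \<in> ?S"
          unfolding Grass_eq using coord_mat_carrier indep by blast
      qed
    qed
  qed (rule finite_pluecker_index)
  then show ?thesis
    unfolding projective_variety_def
    using finite_pluecker_index inj_on_pluecker closedin_pluecker_image assms(1) by blast
qed


section \<open>Systems as matrices\<close>

lemma coeff_poly_one: "coeff (poly p 1) i = (\<Sum>j\<le>degree p. coeff (coeff p j) i)"
  by (simp add: poly_altdef coeff_sum)

text \<open>Setting \<open>t = 1\<close> adds up coefficients over all powers of \<open>t\<close>,
  but in a form of degree \<open>n\<close> the power of \<open>s\<close> determines that of
  \<open>t\<close>, so a single term survives and no information is lost.\<close>

lemma form_coeff_poly_one:
  assumes "form n p"
  shows "coeff (poly p 1) i = (if i \<le> n then coeff (coeff p (n - i)) i else 0)"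
proof -
  have "coeff (coeff p j) i = (if j = n - i then (if i \<le> n then coeff (coeff p (n - i)) i else 0) else 0)" for j
  proof (cases "coeff (coeff p j) i = 0")
    case False
    then have "i + j = n" using assms unfolding form_def by blast
    then show ?thesis by auto
  qed auto
  then have "coeff (poly p 1) i =
      (\<Sum>j\<le>degree p. if j = n - i then (if i \<le> n then coeff (coeff p (n - i)) i else 0) else 0)"
    unfolding coeff_poly_one by (intro sum.cong) auto
  \<comment> \<open>The exponent \<open>n - i\<close> may exceed the degree in \<open>t\<close>, in
    which case the term is missing from the sum and the coefficient is 0 as well.\<close>
  also have "\<dots> = (if i \<le> n then coeff (coeff p (n - i)) i else 0)"
    by (auto simp: sum.delta coeff_eq_0)
  finally show ?thesis .
qed

lemma form_eqI:
  assumes "form n p" "form n q" "\<And>i. i \<le> n \<Longrightarrow> coeff (poly p 1) i = coeff (poly q 1) i"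
  shows "p = q"
proof (intro poly_eqI)
  fix j i
  show "coeff (coeff p j) i = coeff (coeff q j) i"
  proof (cases "i + j = n")
    case True
    then have "i \<le> n" "j = n - i" by auto
    then show ?thesis
      using assms(3)[of i] form_coeff_poly_one[OF assms(1)] form_coeff_poly_one[OF assms(2)] by simp
  next
    case False
    then show ?thesis using assms(1,2) unfolding form_def by metis
  qed
qed

text \<open>The form with terms \<open>a l\<close> times \<open>s\<close> to the power
  \<open>l\<close> and \<open>t\<close> to the power \<open>n - l\<close>; the inner polynomial
  variable is \<open>s\<close>, the outer one \<open>t\<close>.\<close>

definition homogenize :: "nat \<Rightarrow> (nat \<Rightarrow> real) \<Rightarrow> real poly poly" where
  "homogenize n a = (\<Sum>l\<le>n. monom (monom (a l) l) (n - l))"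

lemma form_homogenize: "form n (homogenize n a)"
  unfolding form_def
proof (intro allI impI)
  fix i j assume "coeff (coeff (homogenize n a) j) i \<noteq> 0"
  then have "(\<Sum>l\<le>n. coeff (coeff (monom (monom (a l) l) (n - l)) j) i) \<noteq> 0"
    unfolding homogenize_def by (simp add: coeff_sum)
  then obtain l where "l \<le> n" "coeff (coeff (monom (monom (a l) l) (n - l)) j) i \<noteq> 0"
    using sum.not_neutral_contains_not_neutral[of "\<lambda>l. coeff (coeff (monom (monom (a l) l) (n - l)) j) i" "{..n}"]
    by auto
  then show "i + j = n" by (auto split: if_splits)
qed

lemma coeff_homogenize:
  assumes "i \<le> n"
  shows "coeff (poly (homogenize n a) 1) i = a i"
proof -
  have "poly (homogenize n a) 1 = (\<Sum>l\<le>n. monom (a l) l)"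
    unfolding homogenize_def by (simp add: poly_sum poly_monom)
  then show ?thesis using assms by (simp add: coeff_sum sum.delta)
qed

definition poly_mat :: "nat \<Rightarrow> nat \<Rightarrow> real poly mat \<Rightarrow> real mat" where
  "poly_mat n m P = mat (m + 1) (n + 1) (\<lambda>(i, j). coeff (P $$ (0, i)) j)"

definition sys_mat :: "nat \<Rightarrow> nat \<Rightarrow> real poly poly mat \<Rightarrow> real mat" where
  "sys_mat n m R = poly_mat n m (dehom R)"

definition sys_of_mat :: "nat \<Rightarrow> nat \<Rightarrow> real mat \<Rightarrow> real poly poly mat" where
  "sys_of_mat n m A = mat 1 (m + 1) (\<lambda>(_, i). homogenize n (\<lambda>l. A $$ (i, l)))"

lemma poly_mat_carrier: "poly_mat n m P \<in> carrier_mat (m + 1) (n + 1)"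
  unfolding poly_mat_def by simp

lemma sys_mat_carrier: "sys_mat n m R \<in> carrier_mat (m + 1) (n + 1)"
  unfolding sys_mat_def by (rule poly_mat_carrier)

lemma sys_mat_index:
  assumes "R \<in> form_rows n m" "i \<le> m" "j \<le> n"
  shows "sys_mat n m R $$ (i, j) = coeff (poly (R $$ (0, i)) 1) j"
  using assms unfolding form_rows_def sys_mat_def poly_mat_def dehom_def by auto

lemma sys_of_mat_form_rows: "sys_of_mat n m A \<in> form_rows n m"
  unfolding sys_of_mat_def form_rows_def by (auto simp: form_homogenize)

lemma sys_mat_sys_of_mat:
  assumes "A \<in> carrier_mat (m + 1) (n + 1)"
  shows "sys_mat n m (sys_of_mat n m A) = A"
proof (rule eq_matI)
  fix i j assume "i < dim_row A" "j < dim_col A"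
  then have ij: "i \<le> m" "j \<le> n" using assms by auto
  have "sys_of_mat n m A $$ (0, i) = homogenize n (\<lambda>l. A $$ (i, l))"
    using ij(1) unfolding sys_of_mat_def by simp
  then show "sys_mat n m (sys_of_mat n m A) $$ (i, j) = A $$ (i, j)"
    unfolding sys_mat_index[OF sys_of_mat_form_rows ij] using ij(2) by (simp add: coeff_homogenize)
qed (use assms sys_mat_carrier[of n m] in auto)

lemma sys_mat_inj:
  assumes R: "R \<in> form_rows n m" and R': "R' \<in> form_rows n m" and "sys_mat n m R = sys_mat n m R'"
  shows "R = R'"
proof (rule eq_matI)
  fix i j assume "i < dim_row R'" "j < dim_col R'"
  then have ij: "i = 0" "j < m + 1" using R' unfolding form_rows_def by auto
  have forms: "form n (R $$ (0, j))" "form n (R' $$ (0, j))"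
    using R R' ij(2) unfolding form_rows_def by auto
  have "coeff (poly (R $$ (0, j)) 1) l = coeff (poly (R' $$ (0, j)) 1) l" if "l \<le> n" for l
    using sys_mat_index[OF R, of j l] sys_mat_index[OF R', of j l] that ij(2) assms(3) by simp
  then show "R $$ (i, j) = R' $$ (i, j)" unfolding ij(1) by (rule form_eqI[OF forms])
qed (use R R' in \<open>auto simp: form_rows_def\<close>)

text \<open>The inverse homogenises each entry to degree exactly \<open>n\<close>, whatever its own
  degree; this is why entries of degree at most \<open>n\<close> are the right target.\<close>

lemma dehom_bij: "bij_betw dehom (form_rows n m) (poly_rows n m)"
  unfolding bij_betw_def
proof (intro conjI equalityI subsetI)
  show "inj_on dehom (form_rows n m)"
    by (rule inj_onI) (simp add: sys_mat_inj sys_mat_def)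
next
  fix P assume "P \<in> dehom ` form_rows n m"
  then obtain R where R: "P = dehom R" "R \<in> form_rows n m" by blast
  show "P \<in> poly_rows n m"
    unfolding poly_rows_def
  proof (intro CollectI conjI allI impI)
    show "P \<in> carrier_mat 1 (m + 1)" using R unfolding form_rows_def dehom_def by auto
    fix i assume i: "i < m + 1"
    then have "form n (R $$ (0, i))" using R(2) unfolding form_rows_def by auto
    then have "degree (poly (R $$ (0, i)) 1) \<le> n"
      by (intro degree_le) (simp add: form_coeff_poly_one)
    then show "degree (P $$ (0, i)) \<le> n"
      using R i unfolding form_rows_def dehom_def by auto
  qed
next
  fix P assume P: "P \<in> poly_rows n m"
  let ?R = "sys_of_mat n m (poly_mat n m P)"
  have "dehom ?R = P"
  proof (rule eq_matI)
    fix i j assume "i < dim_row P" "j < dim_col P"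
    then have ij: "i = 0" "j < m + 1" using P unfolding poly_rows_def by auto
    have "poly (homogenize n (\<lambda>l. poly_mat n m P $$ (j, l))) 1 = P $$ (0, j)"
    proof (rule poly_eqI)
      fix l
      show "coeff (poly (homogenize n (\<lambda>l. poly_mat n m P $$ (j, l))) 1) l = coeff (P $$ (0, j)) l"
      proof (cases "l \<le> n")
        case True
        then show ?thesis using ij(2) unfolding coeff_homogenize[OF True] by (simp add: poly_mat_def)
      next
        case False
        moreover have "degree (P $$ (0, j)) \<le> n" using P ij(2) unfolding poly_rows_def by auto
        ultimately show ?thesis
          using form_coeff_poly_one[OF form_homogenize] by (simp add: coeff_eq_0)
      qed
    qed
    then show "dehom ?R $$ (i, j) = P $$ (i, j)"
      using ij unfolding dehom_def sys_of_mat_def by simp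
  qed (use P in \<open>auto simp: dehom_def sys_of_mat_def poly_rows_def\<close>)
  then show "P \<in> dehom ` form_rows n m" using sys_of_mat_form_rows by (metis imageI)
qed

section \<open>Homogeneous coordinates of systems\<close>

lemma sys_index_set: "{..(m :: nat) * n + m + n} = {..<(m + 1) * (n + 1)}"
proof -
  \<comment> \<open>One coordinate for each entry of the coefficient matrix, hence one more than the
    dimension of the projective space.\<close>
  have "(m + 1) * (n + 1) = Suc (m * n + m + n)" by (simp add: algebra_simps)
  then show ?thesis by (simp only: lessThan_Suc_atMost)
qed

lemma mat_index_div_mod:
  assumes "j < (N :: nat)"
  shows "(i * N + j) div N = i" "(i * N + j) mod N = j"
  using assms by simp_all

lemma coord_mat_index:
  "i < k \<Longrightarrow> j < N \<Longrightarrow> coord_mat k N v $$ (i, j) = v (i * N + j)"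
  unfolding coord_mat_def by simp

lemma sys_mat_dims: "dim_row (sys_mat n m R) = m + 1" "dim_col (sys_mat n m R) = n + 1"
  using carrier_matD[OF sys_mat_carrier] .

lemma coords_eq:
  "coords n m R l = (if l < (m + 1) * (n + 1) then sys_mat n m R $$ (l div (n + 1), l mod (n + 1)) else 0)"
proof -
  have "l \<le> m * n + m + n \<longleftrightarrow> l < (m + 1) * (n + 1)"
    using sys_index_set[of m n] by (metis atMost_iff lessThan_iff)
  moreover have "l div (n + 1) < m + 1" if "l < (m + 1) * (n + 1)"
    using that by (simp only: less_mult_imp_div_less)
  moreover have "l mod (n + 1) < n + 1" by simp
  ultimately show ?thesis unfolding coords_def sys_mat_def poly_mat_def by simp
qed

text \<open>The row by row layout of \<open>coord_mat\<close> agrees with the numbering in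
  \<open>coords\<close>, so forms in the coordinates of a system can be written as functions of its
  coefficient matrix.\<close>

lemma coord_mat_coords: "coord_mat (m + 1) (n + 1) (coords n m R) = sys_mat n m R"
proof (rule eq_matI)
  fix i j assume "i < dim_row (sys_mat n m R)" "j < dim_col (sys_mat n m R)"
  then have ij: "i < m + 1" "j < n + 1" using sys_mat_carrier[of n m R] by auto
  show "coord_mat (m + 1) (n + 1) (coords n m R) $$ (i, j) = sys_mat n m R $$ (i, j)"
    by (simp only: coord_mat_index[OF ij] coords_eq mat_index_less[OF ij] mat_index_div_mod[OF ij(2)] if_True)
qed (use sys_mat_carrier[of n m R] in \<open>auto simp: coord_mat_def\<close>)

lemma coords_inj:
  "R \<in> form_rows n m \<Longrightarrow> R' \<in> form_rows n m \<Longrightarrow> coords n m R = coords n m R' \<Longrightarrow> R = R'"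
  by (rule sys_mat_inj) (assumption+, simp only: coord_mat_coords[symmetric])

lemma coords_sys_of_mat:
  assumes "A \<in> carrier_mat (m + 1) (n + 1)"
  shows "coords n m (sys_of_mat n m A) l =
    (if l < (m + 1) * (n + 1) then A $$ (l div (n + 1), l mod (n + 1)) else 0)"
  unfolding coords_eq sys_mat_sys_of_mat[OF assms] ..

lemma coords_surj:
  assumes "\<And>l. l \<notin> {..m * n + m + n} \<Longrightarrow> v l = 0"
  shows "coords n m (sys_of_mat n m (coord_mat (m + 1) (n + 1) v)) = v"
proof
  fix l
  show "coords n m (sys_of_mat n m (coord_mat (m + 1) (n + 1) v)) l = v l"
  proof (cases "l < (m + 1) * (n + 1)")
    case True
    then have i: "l div (n + 1) < m + 1" by (simp only: less_mult_imp_div_less)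
    have j: "l mod (n + 1) < n + 1" by simp
    show ?thesis
      by (simp only: coords_sys_of_mat[OF coord_mat_carrier] coord_mat_index[OF i j] div_mult_mod_eq
          True if_True)
  next
    case False
    then show ?thesis
      using assms[of l] unfolding coords_sys_of_mat[OF coord_mat_carrier] sys_index_set by simp
  qed
qed


section \<open>Scaling and the projective space of systems\<close>

lemma coeff_const_mult: "coeff (coeff ([:[:c:]:] * p) j) i = c * coeff (coeff p j) i"
  by simp

lemma form_const_mult: "form n p \<Longrightarrow> form n ([:[:c:]:] * p)"
  unfolding form_def coeff_const_mult by simp

lemma form_rows_scale: "R \<in> form_rows n m \<Longrightarrow> [:[:c:]:] \<cdot>\<^sub>m R \<in> form_rows n m"
  unfolding form_rows_def by (auto simp del: mult_pCons_left simp: form_const_mult)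

lemma sys_mat_scale:
  assumes "R \<in> form_rows n m"
  shows "sys_mat n m ([:[:c:]:] \<cdot>\<^sub>m R) = c \<cdot>\<^sub>m sys_mat n m R"
proof (rule eq_matI)
  fix i j assume "i < dim_row (c \<cdot>\<^sub>m sys_mat n m R)" "j < dim_col (c \<cdot>\<^sub>m sys_mat n m R)"
  then have ij: "i \<le> m" "j \<le> n" using sys_mat_carrier[of n m R] by auto
  have "([:[:c:]:] \<cdot>\<^sub>m R) $$ (0, i) = [:[:c:]:] * R $$ (0, i)"
    using assms ij unfolding form_rows_def by auto
  then have "sys_mat n m ([:[:c:]:] \<cdot>\<^sub>m R) $$ (i, j) = c * sys_mat n m R $$ (i, j)"
    unfolding sys_mat_index[OF form_rows_scale[OF assms] ij] sys_mat_index[OF assms ij] by simp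
  then show "sys_mat n m ([:[:c:]:] \<cdot>\<^sub>m R) $$ (i, j) = (c \<cdot>\<^sub>m sys_mat n m R) $$ (i, j)"
    using ij sys_mat_carrier[of n m R] by auto
qed (simp_all add: sys_mat_dims)

lemma coords_scale:
  assumes "R \<in> form_rows n m"
  shows "coords n m ([:[:c:]:] \<cdot>\<^sub>m R) = (\<lambda>l. c * coords n m R l)"
proof
  fix l
  show "coords n m ([:[:c:]:] \<cdot>\<^sub>m R) l = c * coords n m R l"
  proof (cases "l < (m + 1) * (n + 1)")
    case True
    then have i: "l div (n + 1) < dim_row (sys_mat n m R)"
      unfolding sys_mat_dims by (simp only: less_mult_imp_div_less)
    have j: "l mod (n + 1) < dim_col (sys_mat n m R)" unfolding sys_mat_dims by simp
    show ?thesis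
      by (simp only: coords_eq sys_mat_scale[OF assms] True if_True index_smult_mat(1)[OF i j])
  qed (simp only: coords_eq if_False mult_zero_right)
qed

lemma AR_proj_sys_class:
  assumes "R \<in> form_rows n m"
  shows "AR_proj n m (sys_class R) = proj_point (coords n m R)"
proof -
  have "coords n m ` {[:[:c:]:] \<cdot>\<^sub>m R | c. c \<noteq> 0} = {coords n m ([:[:c:]:] \<cdot>\<^sub>m R) | c. c \<noteq> 0}"
    by blast
  then show ?thesis unfolding AR_proj_def sys_class_def proj_point_def coords_scale[OF assms] .
qed

lemma sys_class_self: "R \<in> sys_class R"
proof -
  have "[:[:1:]:] \<cdot>\<^sub>m R = R" by (intro eq_matI) (auto simp flip: one_pCons)
  then show ?thesis unfolding sys_class_def by (intro CollectI exI[of _ 1]) simp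
qed

lemma sys_class_scale:
  assumes "c \<noteq> 0"
  shows "sys_class ([:[:c:]:] \<cdot>\<^sub>m R) = sys_class R"
proof -
  have mult: "[:[:b:]:] \<cdot>\<^sub>m ([:[:c:]:] \<cdot>\<^sub>m R) = [:[:b * c:]:] \<cdot>\<^sub>m R" for b
    by (intro eq_matI) (auto simp: mult.assoc)
  have "{[:[:b * c:]:] \<cdot>\<^sub>m R | b. b \<noteq> 0} = {[:[:b:]:] \<cdot>\<^sub>m R | b. b \<noteq> 0}"
  proof (intro equalityI subsetI)
    fix X assume "X \<in> {[:[:b * c:]:] \<cdot>\<^sub>m R | b. b \<noteq> 0}"
    then obtain b where "X = [:[:b * c:]:] \<cdot>\<^sub>m R" "b \<noteq> 0" by blast
    with assms show "X \<in> {[:[:b:]:] \<cdot>\<^sub>m R | b. b \<noteq> 0}" by (intro CollectI exI[of _ "b * c"]) simp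
  next
    fix X assume "X \<in> {[:[:b:]:] \<cdot>\<^sub>m R | b. b \<noteq> 0}"
    then obtain b where "X = [:[:b:]:] \<cdot>\<^sub>m R" "b \<noteq> 0" by blast
    with assms show "X \<in> {[:[:b * c:]:] \<cdot>\<^sub>m R | b. b \<noteq> 0}"
      by (intro CollectI exI[of _ "b / c"]) simp
  qed
  then show ?thesis unfolding sys_class_def mult .
qed

lemma ARE:
  assumes "x \<in> AR n m" "R \<in> x"
  shows "R \<in> form_rows n m" "x = sys_class R" "R \<noteq> 0\<^sub>m 1 (m + 1)"
proof -
  obtain R' where R': "x = sys_class R'" "R' \<in> form_rows n m" "R' \<noteq> 0\<^sub>m 1 (m + 1)"
    using assms(1) unfolding AR_def by blast
  obtain c where c: "R = [:[:c:]:] \<cdot>\<^sub>m R'" "c \<noteq> 0" using assms(2) unfolding R'(1) sys_class_def by blast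
  show "R \<in> form_rows n m" unfolding c(1) by (rule form_rows_scale[OF R'(2)])
  show "x = sys_class R" unfolding c(1) R'(1) by (rule sys_class_scale[OF c(2), symmetric])
  show "R \<noteq> 0\<^sub>m 1 (m + 1)"
  proof
    assume "R = 0\<^sub>m 1 (m + 1)"
    have R'_car: "R' \<in> carrier_mat 1 (m + 1)" using R'(2) unfolding form_rows_def by simp
    have "R' $$ (0, i) = 0" if "i < m + 1" for i
    proof -
      have "[:[:c:]:] * R' $$ (0, i) = R $$ (0, i)" unfolding c(1) using R'_car that by auto
      also have "\<dots> = 0" unfolding \<open>R = 0\<^sub>m 1 (m + 1)\<close> using that by simp
      finally show ?thesis using c(2) by (metis mult_eq_0_iff pCons_eq_0_iff)
    qed
    then have "R' = 0\<^sub>m 1 (m + 1)" using R'_car by (intro eq_matI) auto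
    with R'(3) show False by simp
  qed
qed

lemma AR_nonempty: "x \<in> AR n m \<Longrightarrow> \<exists>R. R \<in> x"
  unfolding AR_def using sys_class_self by auto

lemma sys_class_AR: "R \<in> form_rows n m \<Longrightarrow> R \<noteq> 0\<^sub>m 1 (m + 1) \<Longrightarrow> sys_class R \<in> AR n m"
  unfolding AR_def by blast

lemma zero_form_rows: "0\<^sub>m 1 (m + 1) \<in> form_rows n m"
  unfolding form_rows_def form_def by auto

lemma coords_eq_0_iff:
  assumes "R \<in> form_rows n m"
  shows "coords n m R = (\<lambda>l. 0) \<longleftrightarrow> R = 0\<^sub>m 1 (m + 1)"
proof -
  \<comment> \<open>The zero row is its own multiple by 0, so the scaling rule yields its
    coordinates.\<close>
  have "coords n m (0\<^sub>m 1 (m + 1)) = coords n m ([:[:0:]:] \<cdot>\<^sub>m 0\<^sub>m 1 (m + 1))"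
    by (intro arg_cong[of _ _ "coords n m"] eq_matI) auto
  also have "\<dots> = (\<lambda>l. 0)" unfolding coords_scale[OF zero_form_rows] by simp
  finally show ?thesis using coords_inj[OF assms zero_form_rows] by auto
qed

lemma AR_proj_bij: "bij_betw (AR_proj n m) (AR n m) (proj_space {..m * n + m + n})"
  unfolding bij_betw_def
proof (intro conjI equalityI subsetI)
  show "inj_on (AR_proj n m) (AR n m)"
  proof (rule inj_onI)
    fix x y assume x: "x \<in> AR n m" and y: "y \<in> AR n m" and eq: "AR_proj n m x = AR_proj n m y"
    obtain R R' where R: "R \<in> x" and R': "R' \<in> y" using AR_nonempty x y by blast
    note RD = ARE[OF x R] and RD' = ARE[OF y R']
    have "coords n m R' \<in> proj_point (coords n m R)"
      using eq proj_point_self unfolding RD(2) RD'(2) AR_proj_sys_class[OF RD(1)] AR_proj_sys_class[OF RD'(1)]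
      by auto
    then obtain c where c: "c \<noteq> 0" "coords n m R' = (\<lambda>l. c * coords n m R l)"
      unfolding proj_point_def by blast
    then have "R' = [:[:c:]:] \<cdot>\<^sub>m R"
      by (intro coords_inj[OF RD'(1) form_rows_scale[OF RD(1)]]) (simp add: coords_scale[OF RD(1)])
    then show "x = y" using RD(2) RD'(2) sys_class_scale[OF c(1)] by simp
  qed
next
  fix p assume "p \<in> AR_proj n m ` AR n m"
  then obtain x where x: "x \<in> AR n m" "p = AR_proj n m x" by blast
  obtain R where R: "R \<in> x" using AR_nonempty x by blast
  note RD = ARE[OF x(1) R]
  have "coords n m R \<noteq> (\<lambda>l. 0)" using coords_eq_0_iff[OF RD(1)] RD(3) by blast
  then obtain l where "coords n m R l \<noteq> 0" by blast
  then show "p \<in> proj_space {..m * n + m + n}"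
    unfolding x(2) RD(2) AR_proj_sys_class[OF RD(1)]
    by (rule proj_point_in_proj_space[rotated]) (simp add: coords_def)
next
  fix p assume p: "p \<in> proj_space {..m * n + m + n}"
  then obtain v where v: "v \<in> p" using proj_space_nonempty by blast
  note vp = proj_spaceD[OF p v]
  let ?R = "sys_of_mat n m (coord_mat (m + 1) (n + 1) v)"
  have R: "?R \<in> form_rows n m" by (rule sys_of_mat_form_rows)
  have co: "coords n m ?R = v" by (rule coords_surj[OF vp(2)])
  then have "?R \<noteq> 0\<^sub>m 1 (m + 1)" using coords_eq_0_iff[OF R] vp(3) by auto
  then have "sys_class ?R \<in> AR n m" by (rule sys_class_AR[OF R])
  moreover have "AR_proj n m (sys_class ?R) = p" unfolding AR_proj_sys_class[OF R] co vp(1) ..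
  ultimately show "p \<in> AR_proj n m ` AR n m" by blast
qed

lemma coeff_vec_bij: "bij_betw (coeff_vec n) {p. degree p \<le> n} (carrier_vec (n + 1))"
proof (rule bij_betw_byWitness[where f' = "\<lambda>v. \<Sum>l\<le>n. monom (v $ l) l"])
  show "\<forall>p\<in>{p. degree p \<le> n}. (\<Sum>l\<le>n. monom (coeff_vec n p $ l) l) = p"
    by (auto simp: coeff_vec_def poly_eq_iff coeff_sum sum.delta coeff_eq_0)
  show "\<forall>v\<in>carrier_vec (n + 1). coeff_vec n (\<Sum>l\<le>n. monom (v $ l) l) = v"
    by (auto simp: coeff_vec_def coeff_sum sum.delta)
  show "coeff_vec n ` {p. degree p \<le> n} \<subseteq> carrier_vec (n + 1)" by (auto simp: coeff_vec_def)
  show "(\<lambda>v. \<Sum>l\<le>n. monom (v $ l) l) ` carrier_vec (n + 1) \<subseteq> {p. degree p \<le> n}"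
    by (auto intro!: degree_sum_le order.trans[OF degree_monom_le])
qed


section \<open>The feedback action\<close>

text \<open>Invertibility supplies some two-sided inverse without a stated shape. Its shape follows
  from the dimensions of the two products, and then a nonzero determinant guarantees that
  \<open>mat_inverse\<close> returns a value.\<close>

lemma GL_inverse:
  assumes "T \<in> GL k"
  shows "the (mat_inverse T) \<in> carrier_mat k k" "T * the (mat_inverse T) = 1\<^sub>m k"
    "the (mat_inverse T) * T = 1\<^sub>m k"
proof -
  have T: "T \<in> carrier_mat k k" "invertible_mat T" using assms unfolding GL_def by auto
  then obtain B where B: "T * B = 1\<^sub>m (dim_row T)" "B * T = 1\<^sub>m (dim_row B)"
    unfolding invertible_mat_def inverts_mat_def by blast
  have "dim_row T = k" "dim_col T = k" using T(1) by auto
  then have "dim_col B = k" "dim_row B = k"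
    using arg_cong[OF B(1), of dim_col] arg_cong[OF B(2), of dim_col] by simp_all
  then have "B \<in> carrier_mat k k" "T * B = 1\<^sub>m k" using B(1) T(1) by auto
  then have "det T * det B = 1" using det_mult[OF T(1), of B] by simp
  then have "det T \<noteq> 0" by auto
  then have "T \<in> Units (ring_mat TYPE(real) k ())" by (rule det_non_zero_imp_unit[OF T(1)])
  then obtain S where S: "mat_inverse T = Some S"
    using mat_inverse(1)[OF T(1), of "()"] by (cases "mat_inverse T") auto
  from mat_inverse(2)[OF T(1) S]
  show "the (mat_inverse T) \<in> carrier_mat k k" "T * the (mat_inverse T) = 1\<^sub>m k"
    "the (mat_inverse T) * T = 1\<^sub>m k" unfolding S by auto
qed

lemma GL_det_inverse:
  assumes "T \<in> GL k"
  shows "det T * det (the (mat_inverse T)) = 1"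
proof -
  have "T \<in> carrier_mat k k" using assms unfolding GL_def by simp
  from det_mult[OF this GL_inverse(1)[OF assms]] GL_inverse(2)[OF assms] show ?thesis by simp
qed

text \<open>The group acts through inverses, so a prescribed matrix has to be realised as the
  inverse of a group element.\<close>

lemma GL_with_inverse:
  assumes "G \<in> carrier_mat k k" "det G \<noteq> 0"
  obtains T where "T \<in> GL k" "the (mat_inverse T) = G"
proof -
  obtain T where T: "T \<in> carrier_mat k k" "G * T = 1\<^sub>m k" "T * G = 1\<^sub>m k"
    using det_nonzero_inverse[OF assms] .
  have GL: "T \<in> GL k" unfolding GL_def using T(1) invertible_matI[OF T(1) assms(1) T(3,2)] by simp
  note S = GL_inverse[OF GL]
  have "G = G * (T * the (mat_inverse T))" unfolding S(2) using assms(1) by simp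
  also have "\<dots> = (G * T) * the (mat_inverse T)"
    by (rule assoc_mult_mat[OF assms(1) T(1) S(1), symmetric])
  also have "\<dots> = the (mat_inverse T)" unfolding T(2) using S(1) by simp
  finally show ?thesis using GL that by simp
qed

lemma form_sum: "(\<And>i. i \<in> K \<Longrightarrow> form n (p i)) \<Longrightarrow> form n (\<Sum>i\<in>K. p i)"
proof (induction K rule: infinite_finite_induct)
  case (insert i K)
  then have "form n (p i)" "form n (\<Sum>i\<in>K. p i)" by auto
  then have "form n (p i + (\<Sum>i\<in>K. p i))"
    unfolding form_def coeff_add by (metis add.right_neutral)
  with insert show ?case by simp
qed (auto simp: form_def)

lemma row_act_index:
  assumes "R \<in> form_rows n m" "T \<in> GL (m + 1)" "j < m + 1"
  shows "row_act T R $$ (0, j) = (\<Sum>i<m + 1. [:[:the (mat_inverse T) $$ (i, j):]:] * R $$ (0, i))"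
proof -
  have R: "dim_row R = 1" "dim_col R = m + 1" using assms(1) unfolding form_rows_def by auto
  have S: "dim_row (the (mat_inverse T)) = m + 1" "dim_col (the (mat_inverse T)) = m + 1"
    using GL_inverse(1)[OF assms(2)] by auto
  show ?thesis
    unfolding row_act_def using R S assms(3)
    by (simp add: scalar_prod_def mult.commute lessThan_atLeast0 del: mult_pCons_left mult_pCons_right)
qed

lemma row_act_form_rows:
  assumes "R \<in> form_rows n m" "T \<in> GL (m + 1)"
  shows "row_act T R \<in> form_rows n m"
  unfolding form_rows_def
proof (intro CollectI conjI allI impI)
  show "row_act T R \<in> carrier_mat 1 (m + 1)"
    unfolding row_act_def using assms(1) GL_inverse(1)[OF assms(2)] unfolding form_rows_def by auto
  fix j assume "j < m + 1"
  then show "form n (row_act T R $$ (0, j))"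
    unfolding row_act_index[OF assms \<open>j < m + 1\<close>]
    using assms(1) unfolding form_rows_def by (intro form_sum form_const_mult) auto
qed

text \<open>The entries of the polynomial row are the rows of the coefficient matrix, so multiplying
  the row from the right becomes multiplying the matrix from the left by the transpose.\<close>

lemma sys_mat_row_act:
  assumes "R \<in> form_rows n m" "T \<in> GL (m + 1)"
  shows "sys_mat n m (row_act T R) = transpose_mat (the (mat_inverse T)) * sys_mat n m R"
proof (rule eq_matI)
  let ?S = "the (mat_inverse T)"
  have S: "dim_row ?S = m + 1" "dim_col ?S = m + 1" using GL_inverse(1)[OF assms(2)] by auto
  fix j l assume "j < dim_row (transpose_mat ?S * sys_mat n m R)" "l < dim_col (transpose_mat ?S * sys_mat n m R)"
  then have jl: "j < m + 1" "l < n + 1" using S sys_mat_dims[of n m R] by auto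
  then have jl': "j \<le> m" "l \<le> n" by auto
  have "sys_mat n m (row_act T R) $$ (j, l) = (\<Sum>i<m + 1. ?S $$ (i, j) * coeff (poly (R $$ (0, i)) 1) l)"
    unfolding sys_mat_index[OF row_act_form_rows[OF assms] jl'] row_act_index[OF assms jl(1)]
    by (simp add: poly_sum coeff_sum)
  also have "\<dots> = (\<Sum>i<m + 1. ?S $$ (i, j) * sys_mat n m R $$ (i, l))"
    using sys_mat_index[OF assms(1) _ jl'(2)] by (intro sum.cong) auto
  also have "\<dots> = (transpose_mat ?S * sys_mat n m R) $$ (j, l)"
    using S sys_mat_dims[of n m R] jl by (simp add: scalar_prod_def lessThan_atLeast0)
  finally show "sys_mat n m (row_act T R) $$ (j, l) = (transpose_mat ?S * sys_mat n m R) $$ (j, l)" .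
next
  let ?S = "the (mat_inverse T)"
  have S: "dim_row ?S = m + 1" "dim_col ?S = m + 1" using GL_inverse(1)[OF assms(2)] by auto
  show "dim_row (sys_mat n m (row_act T R)) = dim_row (transpose_mat ?S * sys_mat n m R)"
    "dim_col (sys_mat n m (row_act T R)) = dim_col (transpose_mat ?S * sys_mat n m R)"
    using S by (simp_all add: sys_mat_dims)
qed

lemma feedback_sys_class:
  assumes "R \<in> form_rows n m" "T \<in> GL (m + 1)"
  shows "feedback T (sys_class R) = sys_class (row_act T R)"
proof -
  have "row_act T ([:[:c:]:] \<cdot>\<^sub>m R) = [:[:c:]:] \<cdot>\<^sub>m row_act T R" for c
    unfolding row_act_def
    by (rule mult_smult_assoc_mat[of _ 1 "m + 1" _ "m + 1"])
      (use assms(1) GL_inverse(1)[OF assms(2)] in \<open>auto simp: form_rows_def\<close>)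
  moreover have "row_act T ` {[:[:c:]:] \<cdot>\<^sub>m R | c. c \<noteq> 0} = {row_act T ([:[:c:]:] \<cdot>\<^sub>m R) | c. c \<noteq> 0}"
    by blast
  ultimately show ?thesis unfolding feedback_def sys_class_def by simp
qed

text \<open>Every invertible left factor of the coefficient matrix comes from the group:
  \<open>T\<close> is the inverse transpose of \<open>g\<close>, which also explains the relation
  between the determinants.\<close>

lemma feedback_by_matrix:
  assumes "R \<in> form_rows n m" "g \<in> carrier_mat (m + 1) (m + 1)" "det g \<noteq> 0"
  obtains T where "T \<in> GL (m + 1)" "row_act T R = sys_of_mat n m (g * sys_mat n m R)"
    "det T * det g = 1"
proof -
  have "transpose_mat g \<in> carrier_mat (m + 1) (m + 1)" "det (transpose_mat g) \<noteq> 0"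
    using assms(2,3) det_transpose[OF assms(2)] by auto
  then obtain T where T: "T \<in> GL (m + 1)" "the (mat_inverse T) = transpose_mat g"
    using GL_with_inverse by metis
  have prod: "g * sys_mat n m R \<in> carrier_mat (m + 1) (n + 1)"
    by (rule mult_carrier_mat[OF assms(2) sys_mat_carrier])
  have "sys_mat n m (row_act T R) = g * sys_mat n m R"
    unfolding sys_mat_row_act[OF assms(1) T(1)] T(2) by simp
  then have "row_act T R = sys_of_mat n m (g * sys_mat n m R)"
    by (intro sys_mat_inj[OF row_act_form_rows[OF assms(1) T(1)] sys_of_mat_form_rows])
      (simp only: sys_mat_sys_of_mat[OF prod])
  moreover have "det T * det g = 1"
    using GL_det_inverse[OF T(1)] unfolding T(2) det_transpose[OF assms(2)] .
  ultimately show ?thesis using T(1) that by blast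
qed


section \<open>Nondegenerate and semistable systems\<close>

text \<open>Because of the degree bound, a combination of the entries is the zero polynomial as soon
  as its first \<open>n + 1\<close> coefficients vanish, and these are the entries of a vector
  computed from the coefficient matrix.\<close>

lemma nondegenerate_iff_row_indep:
  assumes P: "P \<in> poly_rows n m"
  shows "nondegenerate m P \<longleftrightarrow> row_indep (m + 1) (n + 1) (poly_mat n m P)"
proof -
  have deg: "coeff (P $$ (0, i)) l = 0" if "i < m + 1" "\<not> l < n + 1" for i l
  proof -
    have "degree (P $$ (0, i)) \<le> n" using P that(1) unfolding poly_rows_def by auto
    then show ?thesis using that(2) by (intro coeff_eq_0) simp
  qed
  have dims: "dim_row (poly_mat n m P) = m + 1" "dim_col (poly_mat n m P) = n + 1"
    using poly_mat_carrier[of n m P] by auto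
  have entry: "(transpose_mat (poly_mat n m P) *\<^sub>v vec (m + 1) c) $ l =
      coeff (\<Sum>i<m + 1. Polynomial.smult (c i) (P $$ (0, i))) l" if "l < n + 1" for c l
  proof -
    have "(transpose_mat (poly_mat n m P) *\<^sub>v vec (m + 1) c) $ l =
        (\<Sum>i<m + 1. poly_mat n m P $$ (i, l) * c i)"
      using that dims by (simp add: scalar_prod_def lessThan_atLeast0)
    also have "\<dots> = (\<Sum>i<m + 1. c i * coeff (P $$ (0, i)) l)"
      using that unfolding poly_mat_def by (intro sum.cong) auto
    finally show ?thesis by (simp only: coeff_sum coeff_smult)
  qed
  have zero_iff: "(\<Sum>i<m + 1. Polynomial.smult (c i) (P $$ (0, i))) = 0 \<longleftrightarrow>
      transpose_mat (poly_mat n m P) *\<^sub>v vec (m + 1) c = 0\<^sub>v (n + 1)" for c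
  proof
    assume "(\<Sum>i<m + 1. Polynomial.smult (c i) (P $$ (0, i))) = 0"
    then show "transpose_mat (poly_mat n m P) *\<^sub>v vec (m + 1) c = 0\<^sub>v (n + 1)"
      using dims by (intro eq_vecI) (simp_all only: entry coeff_0 index_zero_vec dim_mult_mat_vec index_transpose_mat)
  next
    assume zero: "transpose_mat (poly_mat n m P) *\<^sub>v vec (m + 1) c = 0\<^sub>v (n + 1)"
    show "(\<Sum>i<m + 1. Polynomial.smult (c i) (P $$ (0, i))) = 0"
    proof (rule poly_eqI)
      fix l
      show "coeff (\<Sum>i<m + 1. Polynomial.smult (c i) (P $$ (0, i))) l = coeff 0 l"
      proof (cases "l < n + 1")
        case True
        then show ?thesis unfolding entry[OF True, symmetric] zero by simp
      next
        case False
        then show ?thesis using deg unfolding coeff_sum coeff_smult by (simp del: sum.lessThan_Suc)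
      qed
    qed
  qed
  show ?thesis
  proof
    assume nd: "nondegenerate m P"
    show "row_indep (m + 1) (n + 1) (poly_mat n m P)"
      unfolding row_indep_def
    proof (intro ballI impI)
      fix c assume c: "c \<in> carrier_vec (m + 1)" "transpose_mat (poly_mat n m P) *\<^sub>v c = 0\<^sub>v (n + 1)"
      have "vec (m + 1) (\<lambda>i. c $ i) = c" using c(1) by (intro eq_vecI) auto
      then have "\<forall>i<m + 1. c $ i = 0"
        using nd zero_iff[of "\<lambda>i. c $ i"] c(2) unfolding nondegenerate_def by simp
      then show "c = 0\<^sub>v (m + 1)" using c(1) by (intro eq_vecI) auto
    qed
  next
    assume indep: "row_indep (m + 1) (n + 1) (poly_mat n m P)"
    show "nondegenerate m P"
      unfolding nondegenerate_def
    proof (intro allI impI)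
      fix c i assume "(\<Sum>i<m + 1. Polynomial.smult (c i) (P $$ (0, i))) = 0" and i: "i < m + 1"
      then have "vec (m + 1) c = 0\<^sub>v (m + 1)"
        using indep unfolding zero_iff row_indep_def by (metis vec_carrier)
      then have "vec (m + 1) c $ i = 0" using i by simp
      then show "c i = 0" using i by simp
    qed
  qed
qed

lemma row_indep_dim_le:
  assumes "A \<in> carrier_mat k N" "row_indep k N A"
  shows "k \<le> N"
proof -
  obtain J where "J \<subseteq> {..<N}" "card J = k"
    using row_indep_imp_minor_nonzero[OF assms] unfolding pluecker_index_def by blast
  then show ?thesis using card_mono[of "{..<N}" J] by simp
qed

lemma poly_span_eq_row_space:
  "poly_span n m P = vec_space.row_space (n + 1) (poly_mat n m P)"
proof -
  have "row (poly_mat n m P) i = coeff_vec n (P $$ (0, i))" if "i < m + 1" for i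
    using that poly_mat_carrier[of n m P] by (intro eq_vecI) (auto simp: poly_mat_def coeff_vec_def)
  moreover have "set (rows (poly_mat n m P)) = row (poly_mat n m P) ` {..<m + 1}"
    unfolding rows_def
    by (simp only: set_map set_upt carrier_matD(1)[OF poly_mat_carrier] lessThan_atLeast0)
  ultimately have "set (rows (poly_mat n m P)) = (\<lambda>i. coeff_vec n (P $$ (0, i))) ` {..<m + 1}"
    by simp
  then show ?thesis unfolding poly_span_def vec_space.row_space_def by simp
qed

lemma dehom_poly_rows: "R \<in> form_rows n m \<Longrightarrow> dehom R \<in> poly_rows n m"
  using dehom_bij[of n m] unfolding bij_betw_def by blast

lemma row_indep_det_mult:
  assumes A: "A \<in> carrier_mat k N" and g: "g \<in> carrier_mat k k" "det g \<noteq> 0"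
  shows "row_indep k N (g * A) \<longleftrightarrow> row_indep k N A"
  unfolding row_indep_iff_minor_nonzero[OF A] row_indep_iff_minor_nonzero[OF mult_carrier_mat[OF g(1) A]]
    minors_mult[OF g(1) A] using g(2) by simp

lemma row_indep_scale:
  assumes "A \<in> carrier_mat k N" "c \<noteq> 0"
  shows "row_indep k N (c \<cdot>\<^sub>m A) \<longleftrightarrow> row_indep k N A"
    "vec_space.row_space N (c \<cdot>\<^sub>m A) = vec_space.row_space N A"
proof -
  have "c \<cdot>\<^sub>m A = (c \<cdot>\<^sub>m 1\<^sub>m k) * A"
    using mult_smult_assoc_mat[OF one_carrier_mat assms(1)] assms(1) by simp
  moreover have "c \<cdot>\<^sub>m 1\<^sub>m k \<in> carrier_mat k k" "det (c \<cdot>\<^sub>m 1\<^sub>m k) \<noteq> 0" using assms(2) by simp_all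
  ultimately show "row_indep k N (c \<cdot>\<^sub>m A) \<longleftrightarrow> row_indep k N A"
    "vec_space.row_space N (c \<cdot>\<^sub>m A) = vec_space.row_space N A"
    using row_indep_det_mult[OF assms(1)] row_space_mult[OF assms(1)] by simp_all
qed

text \<open>Take a relation \<open>c\<close> with \<open>c $ i \<noteq> 0\<close>, scale it to have
  entry 1 at \<open>i\<close> and add it to the unit vector at \<open>i\<close>. The sum
  \<open>x\<close> still combines the rows of \<open>A\<close> to row \<open>i\<close>, but has
  entry 2 there. Replacing row \<open>i\<close> of the identity matrix by \<open>x\<close> therefore
  fixes \<open>A\<close> and has determinant 2.\<close>

lemma row_dependent_stabiliser:
  assumes A: "A \<in> carrier_mat k N" and dep: "\<not> row_indep k N A"
  obtains g where "g \<in> carrier_mat k k" "det g = 2" "g * A = A"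
proof -
  obtain c where c: "c \<in> carrier_vec k" "transpose_mat A *\<^sub>v c = 0\<^sub>v N" "c \<noteq> 0\<^sub>v k"
    using dep unfolding row_indep_def by blast
  then obtain i where i: "i < k" "c $ i \<noteq> 0"
    by (metis carrier_vecD eq_vecI index_zero_vec)
  define x where "x = unit_vec k i + (1 / c $ i) \<cdot>\<^sub>v c"
  have x: "x \<in> carrier_vec k" unfolding x_def using c(1) by simp
  define G where "G = replace_col (1\<^sub>m k) x i"
  have G: "G \<in> carrier_mat k k" unfolding G_def replace_col_def by simp
  \<comment> \<open>Cramer's rule for the identity matrix: replacing column \<open>i\<close> by
    \<open>x\<close> gives determinant \<open>x $ i\<close>.\<close>
  have "det G = x $ i * det (1\<^sub>m k)"
    unfolding G_def using cramer_lemma_mat[of "1\<^sub>m k" k x i] x i(1) by simp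
  then have det: "det (transpose_mat G) = 2"
    unfolding det_transpose[OF G] using i c(1) by (simp add: x_def)
  have col: "transpose_mat A *\<^sub>v x = row A i"
  proof -
    have "transpose_mat A *\<^sub>v x = transpose_mat A *\<^sub>v unit_vec k i + (1 / c $ i) \<cdot>\<^sub>v (transpose_mat A *\<^sub>v c)"
      unfolding x_def using A c(1)
      by (simp add: mult_add_distrib_mat_vec[of _ N k] mult_mat_vec[of _ N k])
    also have "\<dots> = row A i" using A i(1) unfolding c(2) by (intro eq_vecI) auto
    finally show ?thesis .
  qed
  have "transpose_mat G \<in> carrier_mat k k" using G by simp
  moreover have "transpose_mat G * A = A"
  proof (rule eq_matI)
    fix r l assume "r < dim_row A" "l < dim_col A"
    then have rl: "r < k" "l < N" using A by auto
    show "(transpose_mat G * A) $$ (r, l) = A $$ (r, l)"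
    proof (cases "r = i")
      case True
      have "col G i = x" using i(1) x unfolding G_def replace_col_def by (intro eq_vecI) auto
      then have "(transpose_mat G * A) $$ (r, l) = x \<bullet> col A l" using True rl G A by simp
      also have "\<dots> = (transpose_mat A *\<^sub>v x) $ l"
        using rl A x by (simp add: comm_scalar_prod[of _ k])
      also have "\<dots> = A $$ (r, l)" unfolding col using True rl A by simp
      finally show ?thesis .
    next
      case False
      have "col G r = unit_vec k r" using False rl(1) unfolding G_def replace_col_def by (intro eq_vecI) auto
      then show ?thesis using rl G A by simp
    qed
  qed (use G A in auto)
  ultimately show ?thesis using that[OF _ det] by blast
qed

text \<open>The minors are multiplied by the determinant of the inverse of \<open>T\<close>, which
  one factor \<open>det T\<close> cancels, and they have degree \<open>m + 1\<close>. They are thus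
  sections for the exponent \<open>d = 1\<close>.\<close>

lemma minors_invariant_section:
  "invariant_section n m 1 (\<lambda>v. minors (m + 1) (n + 1) (coord_mat (m + 1) (n + 1) v) J)"
  unfolding invariant_section_def sys_index_set
proof (intro conjI ballI)
  show "homogeneous {..<(m + 1) * (n + 1)} (1 * (m + 1))
      (\<lambda>v. minors (m + 1) (n + 1) (coord_mat (m + 1) (n + 1) v) J)"
    using homogeneous_minors[OF homogeneous_coord_mat coord_mat_carrier, of "m + 1" "n + 1" J]
    by (simp add: mult.commute)
  fix T R assume TR: "T \<in> GL (m + 1)" "R \<in> form_rows n m"
  have S: "transpose_mat (the (mat_inverse T)) \<in> carrier_mat (m + 1) (m + 1)"
    using GL_inverse(1)[OF TR(1)] by simp
  show "det T ^ 1 * minors (m + 1) (n + 1) (coord_mat (m + 1) (n + 1) (coords n m (row_act T R))) J =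
      minors (m + 1) (n + 1) (coord_mat (m + 1) (n + 1) (coords n m R)) J"
    unfolding coord_mat_coords sys_mat_row_act[OF TR(2,1)] minors_mult[OF S sys_mat_carrier]
      det_transpose[OF GL_inverse(1)[OF TR(1)]]
    using GL_det_inverse[OF TR(1)] by (simp flip: mult.assoc)
qed

lemma semistable_iff:
  assumes x: "x \<in> AR n m" and R: "R \<in> x"
  shows "semistable n m x \<longleftrightarrow> row_indep (m + 1) (n + 1) (sys_mat n m R)"
proof
  assume "semistable n m x"
  then obtain d F where F: "d > 0" "invariant_section n m d F" "\<forall>R\<in>x. F (coords n m R) \<noteq> 0"
    unfolding semistable_def by (elim exE conjE)
  have R_form: "R \<in> form_rows n m" by (rule ARE(1)[OF x R])
  show "row_indep (m + 1) (n + 1) (sys_mat n m R)"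
  proof (rule ccontr)
    assume "\<not> row_indep (m + 1) (n + 1) (sys_mat n m R)"
    then obtain g where g: "g \<in> carrier_mat (m + 1) (m + 1)" "det g = 2" "g * sys_mat n m R = sys_mat n m R"
      by (rule row_dependent_stabiliser[OF sys_mat_carrier])
    then have "det g \<noteq> 0" by simp
    then obtain T where T: "T \<in> GL (m + 1)" "row_act T R = sys_of_mat n m (g * sys_mat n m R)"
      "det T * det g = 1"
      by (rule feedback_by_matrix[OF R_form g(1)])
    have "row_act T R = R"
      unfolding T(2) g(3)
      by (rule sys_mat_inj[OF sys_of_mat_form_rows R_form sys_mat_sys_of_mat[OF sys_mat_carrier]])
    \<comment> \<open>As \<open>T\<close> fixes \<open>R\<close> and has determinant
      \<open>1 / 2\<close>, invariance compares the nonzero value at \<open>R\<close> with its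
      multiple by a positive power of \<open>1 / 2\<close>.\<close>
    moreover have "det T ^ d * F (coords n m (row_act T R)) = F (coords n m R)"
      using conjunct2[OF F(2)[unfolded invariant_section_def]] T(1) R_form by simp
    ultimately have "det T ^ d = 1" using F(3) R by simp
    moreover have "det T = 1 / 2" using T(3) g(2) by simp
    ultimately show False using F(1) power_less_one_iff[of "1 / 2 :: real" d] by simp
  qed
next
  assume "row_indep (m + 1) (n + 1) (sys_mat n m R)"
  then obtain J where J: "minors (m + 1) (n + 1) (sys_mat n m R) J \<noteq> 0"
    using row_indep_imp_minor_nonzero[OF sys_mat_carrier] by blast
  let ?F = "\<lambda>v. minors (m + 1) (n + 1) (coord_mat (m + 1) (n + 1) v) J"
  show "semistable n m x"
    unfolding semistable_def
  proof (intro exI conjI ballI)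
    show "invariant_section n m 1 ?F" by (rule minors_invariant_section)
    then have hom: "homogeneous {..m * n + m + n} (1 * (m + 1)) ?F"
      unfolding invariant_section_def by (rule conjunct1)
    have ps: "AR_proj n m x \<in> proj_space {..m * n + m + n}"
      using AR_proj_bij[of n m] x unfolding bij_betw_def by blast
    fix R' assume "R' \<in> x"
    then have "coords n m R' \<in> AR_proj n m x" "coords n m R \<in> AR_proj n m x"
      using R unfolding AR_proj_def by auto
    moreover have "?F (coords n m R) \<noteq> 0" unfolding coord_mat_coords by (rule J)
    ultimately show "?F (coords n m R') \<noteq> 0"
      using homogeneous_nonzero_on_point[OF hom ps, of "coords n m R" "coords n m R'"] by simp
  qed simp
qed

lemma AR_ssE:
  assumes "x \<in> AR_ss n m" "R \<in> x"
  shows "R \<in> form_rows n m" "x = sys_class R" "row_indep (m + 1) (n + 1) (sys_mat n m R)" "x \<in> AR n m"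
  using assms semistable_iff ARE unfolding AR_ss_def by auto

lemma AR_ss_nonempty: "x \<in> AR_ss n m \<Longrightarrow> \<exists>R. R \<in> x"
  unfolding AR_ss_def using AR_nonempty by auto

lemma sys_class_AR_ss:
  assumes "R \<in> form_rows n m" "row_indep (m + 1) (n + 1) (sys_mat n m R)"
  shows "sys_class R \<in> AR_ss n m"
proof -
  obtain J where J: "minors (m + 1) (n + 1) (sys_mat n m R) J \<noteq> 0"
    using row_indep_imp_minor_nonzero[OF sys_mat_carrier assms(2)] by blast
  have "R \<noteq> 0\<^sub>m 1 (m + 1)"
  proof
    assume "R = 0\<^sub>m 1 (m + 1)"
    then have "coords n m R = (\<lambda>l. 0)" using coords_eq_0_iff[OF assms(1)] by simp
    then have "coord_mat (m + 1) (n + 1) (coords n m R) = 0\<^sub>m (m + 1) (n + 1)"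
      unfolding coord_mat_def by (intro eq_matI) auto
    \<comment> \<open>Writing the zero matrix with a square zero factor makes all minors vanish by
      multiplicativity; the factor has size at least 1, so its determinant is 0.\<close>
    then have "sys_mat n m R = 0\<^sub>m (m + 1) (m + 1) * 0\<^sub>m (m + 1) (n + 1)"
      unfolding coord_mat_coords by simp
    then have "minors (m + 1) (n + 1) (sys_mat n m R) J = 0"
      using minors_mult[of "0\<^sub>m (m + 1) (m + 1)" "m + 1" "0\<^sub>m (m + 1) (n + 1)" "n + 1" J]
        det_zero[of "m + 1"] by simp
    with J show False by simp
  qed
  then have "sys_class R \<in> AR n m" by (rule sys_class_AR[OF assms(1)])
  then show ?thesis unfolding AR_ss_def using semistable_iff[OF _ sys_class_self] assms(2) by blast
qed

text \<open>Representatives of a system differ by a nonzero scalar, which does not change the row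
  space, so the definite description in \<open>sys_subspace\<close> denotes.\<close>

lemma sys_subspace_eq:
  assumes "x \<in> AR_ss n m" "R \<in> x"
  shows "sys_subspace n m x = vec_space.row_space (n + 1) (sys_mat n m R)"
    and "poly_span n m (dehom R) = sys_subspace n m x"
    and "sys_subspace n m x \<in> Grass (m + 1) (n + 1)"
proof -
  note xD = AR_ssE[OF assms]
  have span: "poly_span n m (dehom R') = vec_space.row_space (n + 1) (sys_mat n m R)" if "R' \<in> x" for R'
  proof -
    from that obtain c where c: "c \<noteq> 0" "R' = [:[:c:]:] \<cdot>\<^sub>m R"
      unfolding xD(2) sys_class_def by blast
    have "sys_mat n m R' = c \<cdot>\<^sub>m sys_mat n m R" unfolding c(2) by (rule sys_mat_scale[OF xD(1)])
    then show ?thesis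
      unfolding poly_span_eq_row_space sys_mat_def[symmetric]
      using row_indep_scale(2)[OF sys_mat_carrier c(1)] by simp
  qed
  show eq: "sys_subspace n m x = vec_space.row_space (n + 1) (sys_mat n m R)"
    unfolding sys_subspace_def
  proof (rule the_equality)
    show "\<forall>R'\<in>x. poly_span n m (dehom R') = vec_space.row_space (n + 1) (sys_mat n m R)"
      using span by blast
    fix W assume "\<forall>R'\<in>x. poly_span n m (dehom R') = W"
    with assms(2) span[OF assms(2)] show "W = vec_space.row_space (n + 1) (sys_mat n m R)" by simp
  qed
  show "poly_span n m (dehom R) = sys_subspace n m x" unfolding eq by (rule span[OF assms(2)])
  show "sys_subspace n m x \<in> Grass (m + 1) (n + 1)"
    unfolding eq Grass_eq using sys_mat_carrier xD(3) by blast
qed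


section \<open>The quotient\<close>

lemma AR_proj_AR_ss: "AR_proj n m ` AR_ss n m \<subseteq> proj_space {..m * n + m + n}"
  using AR_proj_bij[of n m] unfolding AR_ss_def bij_betw_def by blast

lemma topspace_AR_ss_space: "topspace (topo (AR_ss_space n m)) = AR_ss n m"
  unfolding AR_ss_space_def by (rule topspace_embedded[OF AR_proj_AR_ss])

lemma topspace_Grass_space: "k > 0 \<Longrightarrow> topspace (topo (Grass_space k N)) = Grass k N"
  unfolding Grass_space_def by (rule topspace_embedded[OF pluecker_in_proj_space])

lemma AR_proj_memberE:
  assumes "x \<in> AR_ss n m" "v \<in> AR_proj n m x"
  obtains R where "R \<in> x" "v = coords n m R"
  using assms unfolding AR_proj_def by blast

text \<open>The semi-stable locus is the union of the nonvanishing loci of the maximal minors of the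
  coefficient matrix.\<close>

lemma openin_AR_ss: "openin (zariski {..m * n + m + n}) (AR_proj n m ` AR_ss n m)"
proof -
  let ?k = "m + 1" and ?N = "n + 1"
  let ?\<F> = "range (\<lambda>J v. minors ?k ?N (coord_mat ?k ?N v) J)"
  have "zariski_open {..m * n + m + n} (AR_proj n m ` AR_ss n m)"
  proof (rule zariski_openI[of ?\<F>])
    show "\<exists>d. homogeneous {..m * n + m + n} d F" if "F \<in> ?\<F>" for F
    proof -
      from that obtain J where "F = (\<lambda>v. minors ?k ?N (coord_mat ?k ?N v) J)" by (rule rangeE)
      with minors_invariant_section[of n m J] show ?thesis unfolding invariant_section_def by auto
    qed
    show "AR_proj n m ` AR_ss n m \<subseteq> proj_space {..m * n + m + n}" by (rule AR_proj_AR_ss)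
    fix p v assume p: "p \<in> proj_space {..m * n + m + n}" and v: "v \<in> p"
    obtain x where x: "x \<in> AR n m" "p = AR_proj n m x"
      using p AR_proj_bij[of n m] unfolding bij_betw_def by blast
    obtain R where R: "R \<in> x" "v = coords n m R" using v unfolding x(2) AR_proj_def by blast
    have "p \<in> AR_proj n m ` AR_ss n m \<longleftrightarrow> x \<in> AR_ss n m"
    proof
      assume "p \<in> AR_proj n m ` AR_ss n m"
      then obtain y where y: "y \<in> AR_ss n m" "AR_proj n m x = AR_proj n m y" unfolding x(2) by blast
      moreover have "y \<in> AR n m" using y(1) unfolding AR_ss_def by simp
      ultimately show "x \<in> AR_ss n m"
        using inj_onD[OF bij_betw_imp_inj_on[OF AR_proj_bij], of n m x y] x(1) by simp
    qed (use x in blast)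
    also have "\<dots> \<longleftrightarrow> row_indep ?k ?N (sys_mat n m R)"
      unfolding AR_ss_def using x(1) semistable_iff[OF x(1) R(1)] by simp
    also have "\<dots> \<longleftrightarrow> (\<exists>J. minors ?k ?N (sys_mat n m R) J \<noteq> 0)"
      unfolding row_indep_iff_minor_nonzero[OF sys_mat_carrier] using minors_outside by blast
    also have "\<dots> \<longleftrightarrow> (\<exists>F\<in>?\<F>. F v \<noteq> 0)"
      unfolding R(2) by (simp only: bex_simps coord_mat_coords UNIV_I simp_thms)
    finally show "p \<in> AR_proj n m ` AR_ss n m \<longleftrightarrow> (\<exists>F\<in>?\<F>. F v \<noteq> 0)" .
  qed
  then show ?thesis unfolding openin_zariski .
qed

lemma sys_of_mat_AR_ss:
  assumes "A \<in> carrier_mat (m + 1) (n + 1)" "row_indep (m + 1) (n + 1) A"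
  shows "sys_class (sys_of_mat n m A) \<in> AR_ss n m"
    and "sys_subspace n m (sys_class (sys_of_mat n m A)) = vec_space.row_space (n + 1) A"
proof -
  note A = sys_mat_sys_of_mat[OF assms(1)]
  show x: "sys_class (sys_of_mat n m A) \<in> AR_ss n m"
    by (rule sys_class_AR_ss[OF sys_of_mat_form_rows]) (simp only: A assms(2))
  show "sys_subspace n m (sys_class (sys_of_mat n m A)) = vec_space.row_space (n + 1) A"
    unfolding sys_subspace_eq(1)[OF x sys_class_self] A ..
qed

section \<open>The subspace map: image, fibres, and descent of morphisms\<close>

lemma sys_subspace_surj: "sys_subspace n m ` AR_ss n m = Grass (m + 1) (n + 1)"
proof (intro equalityI subsetI)
  fix W assume "W \<in> sys_subspace n m ` AR_ss n m"
  then show "W \<in> Grass (m + 1) (n + 1)" using sys_subspace_eq(3) AR_ss_nonempty by blast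
next
  fix W assume "W \<in> Grass (m + 1) (n + 1)"
  then obtain A where "A \<in> carrier_mat (m + 1) (n + 1)" "row_indep (m + 1) (n + 1) A"
    "W = vec_space.row_space (n + 1) A" unfolding Grass_eq by blast
  then show "W \<in> sys_subspace n m ` AR_ss n m" using sys_of_mat_AR_ss[of A m n] by (metis image_eqI)
qed

lemma orbit_eq_fibre:
  assumes x: "x \<in> AR_ss n m"
  shows "orbit (GL (m + 1)) feedback x = {y \<in> AR_ss n m. sys_subspace n m y = sys_subspace n m x}"
proof (intro equalityI subsetI)
  obtain R where R: "R \<in> x" using AR_ss_nonempty[OF x] by blast
  note xD = AR_ssE[OF x R]
  {
    fix y assume "y \<in> orbit (GL (m + 1)) feedback x"
    then obtain T where T: "T \<in> GL (m + 1)" "y = feedback T x" unfolding orbit_def by blast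
    let ?S = "transpose_mat (the (mat_inverse T))"
    have S: "?S \<in> carrier_mat (m + 1) (m + 1)" using GL_inverse(1)[OF T(1)] by simp
    have "det ?S \<noteq> 0"
      using GL_det_inverse[OF T(1)] unfolding det_transpose[OF GL_inverse(1)[OF T(1)]] by auto
    note S = S this
    have y: "y = sys_class (row_act T R)"
      unfolding T(2) by (subst xD(2)) (rule feedback_sys_class[OF xD(1) T(1)])
    have mat: "sys_mat n m (row_act T R) = ?S * sys_mat n m R" by (rule sys_mat_row_act[OF xD(1) T(1)])
    have y_ss: "y \<in> AR_ss n m"
      unfolding y
      by (rule sys_class_AR_ss[OF row_act_form_rows[OF xD(1) T(1)]])
        (simp only: mat row_indep_det_mult[OF sys_mat_carrier S] xD(3))
    have "sys_subspace n m y = sys_subspace n m x"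
      using sys_subspace_eq(1)[OF y_ss, of "row_act T R"] sys_class_self[of "row_act T R"]
      unfolding y mat row_space_mult[OF sys_mat_carrier S] sys_subspace_eq(1)[OF x R] by simp
    with y_ss show "y \<in> {y \<in> AR_ss n m. sys_subspace n m y = sys_subspace n m x}" by simp
  }
  fix y assume "y \<in> {y \<in> AR_ss n m. sys_subspace n m y = sys_subspace n m x}"
  then have y: "y \<in> AR_ss n m" "sys_subspace n m y = sys_subspace n m x" by auto
  obtain R' where R': "R' \<in> y" using AR_ss_nonempty[OF y(1)] by blast
  note yD = AR_ssE[OF y(1) R']
  have "vec_space.row_space (n + 1) (sys_mat n m R') = vec_space.row_space (n + 1) (sys_mat n m R)"
    using y(2) unfolding sys_subspace_eq(1)[OF x R] sys_subspace_eq(1)[OF y(1) R'] .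
  then obtain g where g: "g \<in> carrier_mat (m + 1) (m + 1)" "det g \<noteq> 0"
    "sys_mat n m R' = g * sys_mat n m R"
    by (rule row_space_eq_factor[OF sys_mat_carrier sys_mat_carrier _ yD(3)])
  obtain T where T: "T \<in> GL (m + 1)" "row_act T R = sys_of_mat n m (g * sys_mat n m R)"
    using feedback_by_matrix[OF xD(1) g(1,2)] by blast
  have "row_act T R = R'"
    unfolding T(2) g(3)[symmetric]
    by (rule sys_mat_inj[OF sys_of_mat_form_rows yD(1) sys_mat_sys_of_mat[OF sys_mat_carrier]])
  then have "feedback T x = y"
    using feedback_sys_class[OF xD(1) T(1)] xD(2) yD(2) by simp
  then show "y \<in> orbit (GL (m + 1)) feedback x" unfolding orbit_def using T(1) by blast
qed

text \<open>In Pluecker coordinates the map is given globally by the minors, so the local lift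
  criterion applies to the identity of the Grassmannian, with systems as the source of the lift and
  the constant condition 1.\<close>

lemma morphism_sys_subspace:
  "morphism (AR_ss_space n m) (Grass_space (m + 1) (n + 1)) (sys_subspace n m)"
proof -
  let ?k = "m + 1" and ?N = "n + 1"
  let ?g = "\<lambda>v. minors ?k ?N (coord_mat ?k ?N v)"
  have "morphism (embedded {..m * n + m + n} (AR_proj n m) (AR_ss n m)) (Grass_space ?k ?N) (sys_subspace n m)"
  proof (rule morphism_local_lift[where I = "pluecker_index ?k ?N" and eX = "pluecker ?k ?N"
        and X = "Grass ?k ?N" and f = "\<lambda>W. W"])
    show "finite (pluecker_index ?k ?N)" by (rule finite_pluecker_index)
    show "pluecker ?k ?N ` Grass ?k ?N \<subseteq> proj_space (pluecker_index ?k ?N)"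
      by (rule pluecker_in_proj_space) simp
    show "AR_proj n m ` AR_ss n m \<subseteq> proj_space {..m * n + m + n}" by (rule AR_proj_AR_ss)
    show "morphism (embedded (pluecker_index ?k ?N) (pluecker ?k ?N) (Grass ?k ?N)) (Grass_space ?k ?N) (\<lambda>W. W)"
      unfolding Grass_space_def by (rule morphism_id)
    fix y assume "y \<in> AR_ss n m"
    show "\<exists>D g d e. homogeneous {..m * n + m + n} d D \<and>
        (\<forall>J\<in>pluecker_index ?k ?N. homogeneous {..m * n + m + n} e (\<lambda>v. g v J)) \<and>
        (\<forall>v\<in>AR_proj n m y. D v \<noteq> 0) \<and>
        (\<forall>x\<in>AR_ss n m. \<forall>v\<in>AR_proj n m x. D v \<noteq> 0 \<longrightarrow>
          (\<exists>W\<in>Grass ?k ?N. g v \<in> pluecker ?k ?N W \<and> sys_subspace n m x = W))"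
    proof (intro exI conjI ballI impI)
      show "homogeneous {..m * n + m + n} 0 (\<lambda>v. 1)" by (rule homogeneous_const)
      show "homogeneous {..m * n + m + n} (1 * ?k) (\<lambda>v. ?g v J)" for J
        using minors_invariant_section[of n m J] unfolding invariant_section_def by (rule conjunct1)
      show "(1 :: real) \<noteq> 0" by simp
      fix x v assume x: "x \<in> AR_ss n m" and "v \<in> AR_proj n m x"
      then obtain R where R: "R \<in> x" "v = coords n m R" by (rule AR_proj_memberE)
      show "\<exists>W\<in>Grass ?k ?N. ?g v \<in> pluecker ?k ?N W \<and> sys_subspace n m x = W"
      proof (intro bexI conjI)
        show "?g v \<in> pluecker ?k ?N (sys_subspace n m x)"
          unfolding R(2) coord_mat_coords pluecker_def sys_subspace_eq(1)[OF x R(1)]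
          using sys_mat_carrier by blast
        show "sys_subspace n m x \<in> Grass ?k ?N" by (rule sys_subspace_eq(3)[OF x R(1)])
      qed (rule refl)
    qed
  qed
  then show ?thesis unfolding AR_ss_space_def .
qed

text \<open>The local lift criterion with the roles exchanged: near a subspace with
  \<open>p J \<noteq> 0\<close>, the chart produces from Pluecker coordinates a system spanning it,
  with coordinates linear in \<open>p\<close>. On that locus \<psi> is \<open>f\<close> after this
  section.\<close>

lemma morphism_descends:
  assumes f: "morphism (AR_ss_space n m) Z f"
    and \<psi>: "\<And>x. x \<in> AR_ss n m \<Longrightarrow> \<psi> (sys_subspace n m x) = f x"
  shows "morphism (Grass_space (m + 1) (n + 1)) Z \<psi>"
proof -
  let ?k = "m + 1" and ?N = "n + 1"
  let ?I = "{..m * n + m + n}" and ?J = "pluecker_index ?k ?N"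
  have "morphism (embedded ?J (pluecker ?k ?N) (Grass ?k ?N)) Z \<psi>"
  proof (rule morphism_local_lift[where I = ?I and eX = "AR_proj n m" and X = "AR_ss n m" and f = f])
    show "finite ?I" by simp
    show "AR_proj n m ` AR_ss n m \<subseteq> proj_space ?I" by (rule AR_proj_AR_ss)
    show ps: "pluecker ?k ?N ` Grass ?k ?N \<subseteq> proj_space ?J" by (rule pluecker_in_proj_space) simp
    show "morphism (embedded ?I (AR_proj n m) (AR_ss n m)) Z f" using f unfolding AR_ss_space_def .
    fix W assume W: "W \<in> Grass ?k ?N"
    then have W_ps: "pluecker ?k ?N W \<in> proj_space ?J" using ps by blast
    then obtain p where p: "p \<in> pluecker ?k ?N W" using proj_space_nonempty by blast
    obtain J where J: "J \<in> ?J" "p J \<noteq> 0" using pluecker_nonzero_coordinate[OF W p] by blast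
    let ?g = "\<lambda>v. coords n m (sys_of_mat n m (chart ?k ?N J v))"
    have D: "homogeneous ?J 1 (\<lambda>v. v J)" by (rule homogeneous_coord[OF finite_pluecker_index J(1)])
    show "\<exists>D g d e. homogeneous ?J d D \<and> (\<forall>i\<in>?I. homogeneous ?J e (\<lambda>v. g v i)) \<and>
        (\<forall>v\<in>pluecker ?k ?N W. D v \<noteq> 0) \<and>
        (\<forall>W'\<in>Grass ?k ?N. \<forall>v\<in>pluecker ?k ?N W'. D v \<noteq> 0 \<longrightarrow>
          (\<exists>x\<in>AR_ss n m. g v \<in> AR_proj n m x \<and> \<psi> W' = f x))"
    proof (intro exI conjI ballI impI)
      show "homogeneous ?J 1 (\<lambda>v. v J)" by (rule D)
      show "homogeneous ?J 1 (\<lambda>v. ?g v l)" if "l \<in> ?I" for l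
      proof -
        have l: "l < ?k * ?N" using that sys_index_set[of m n] by blast
        then have i: "l div ?N < ?k" by (simp only: less_mult_imp_div_less)
        have j: "l mod ?N < ?N" by simp
        show ?thesis
          unfolding coords_sys_of_mat[OF chart_carrier] if_P[OF l]
          by (rule homogeneous_chart[OF J(1) i j])
      qed
      show "v J \<noteq> 0" if "v \<in> pluecker ?k ?N W" for v
        by (rule homogeneous_nonzero_on_point[OF D W_ps p that J(2)])
      fix W' v assume v: "W' \<in> Grass ?k ?N" "v \<in> pluecker ?k ?N W'" "v J \<noteq> 0"
      note ch = chart_of_pluecker[OF v(1,2) J(1) v(3)]
      note x = sys_of_mat_AR_ss[OF chart_carrier ch(2)]
      show "\<exists>x\<in>AR_ss n m. ?g v \<in> AR_proj n m x \<and> \<psi> W' = f x"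
      proof (intro bexI conjI)
        show "sys_class (sys_of_mat n m (chart ?k ?N J v)) \<in> AR_ss n m" by (rule x(1))
        show "?g v \<in> AR_proj n m (sys_class (sys_of_mat n m (chart ?k ?N J v)))"
          unfolding AR_proj_def by (rule imageI[OF sys_class_self])
        show "\<psi> W' = f (sys_class (sys_of_mat n m (chart ?k ?N J v)))"
          using \<psi>[OF x(1)] unfolding x(2) ch(1) .
      qed
    qed
  qed
  then show ?thesis unfolding Grass_space_def .
qed

lemma sys_subspace_feedback:
  assumes "x \<in> AR_ss n m" "T \<in> GL (m + 1)"
  shows "sys_subspace n m (feedback T x) = sys_subspace n m x"
  using orbit_eq_fibre[OF assms(1)] assms(2) unfolding orbit_def by blast

lemma categorical_quotient_sys_subspace:
  "categorical_quotient TYPE('z) (GL (m + 1)) feedback (AR_ss_space n m)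
    (Grass_space (m + 1) (n + 1)) (sys_subspace n m)"
  unfolding categorical_quotient_def topspace_AR_ss_space
proof (intro conjI ballI allI impI)
  show "morphism (AR_ss_space n m) (Grass_space (m + 1) (n + 1)) (sys_subspace n m)"
    by (rule morphism_sys_subspace)
  show "sys_subspace n m (feedback T x) = sys_subspace n m x"
    if "T \<in> GL (m + 1)" "x \<in> AR_ss n m" for T x
    by (rule sys_subspace_feedback[OF that(2,1)])
  fix Z :: "'z fun_space" and f
  assume "variety Z \<and> morphism (AR_ss_space n m) Z f \<and>
    (\<forall>g\<in>GL (m + 1). \<forall>x\<in>AR_ss n m. f (feedback g x) = f x)"
  then have f: "morphism (AR_ss_space n m) Z f"
    and inv: "\<And>g x. g \<in> GL (m + 1) \<Longrightarrow> x \<in> AR_ss n m \<Longrightarrow> f (feedback g x) = f x" by auto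
  \<comment> \<open>The value is taken at an arbitrary system describing \<open>W\<close>. The
    choice is harmless on semi-stable systems because a fibre is one orbit, on which
    \<open>f\<close> is constant.\<close>
  define \<psi> where "\<psi> W = f (SOME x. x \<in> AR_ss n m \<and> sys_subspace n m x = W)" for W
  have \<psi>: "\<psi> (sys_subspace n m x) = f x" if x: "x \<in> AR_ss n m" for x
  proof -
    let ?y = "SOME y. y \<in> AR_ss n m \<and> sys_subspace n m y = sys_subspace n m x"
    have "?y \<in> AR_ss n m \<and> sys_subspace n m ?y = sys_subspace n m x"
      by (rule someI[of _ x]) (use x in simp)
    then have "?y \<in> orbit (GL (m + 1)) feedback x" unfolding orbit_eq_fibre[OF x] by simp
    then obtain g where "g \<in> GL (m + 1)" "?y = feedback g x" unfolding orbit_def by blast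
    then show ?thesis unfolding \<psi>_def using inv[OF _ x] by simp
  qed
  show "\<exists>\<psi>. morphism (Grass_space (m + 1) (n + 1)) Z \<psi> \<and> (\<forall>x\<in>AR_ss n m. \<psi> (sys_subspace n m x) = f x) \<and>
    (\<forall>\<psi>'. morphism (Grass_space (m + 1) (n + 1)) Z \<psi>' \<and> (\<forall>x\<in>AR_ss n m. \<psi>' (sys_subspace n m x) = f x) \<longrightarrow>
      (\<forall>y\<in>topspace (topo (Grass_space (m + 1) (n + 1))). \<psi>' y = \<psi> y))"
  proof (intro exI conjI ballI allI impI)
    show "morphism (Grass_space (m + 1) (n + 1)) Z \<psi>" by (rule morphism_descends[OF f \<psi>])
    show "\<psi> (sys_subspace n m x) = f x" if "x \<in> AR_ss n m" for x by (rule \<psi>[OF that])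
    fix \<psi>' W
    assume \<psi>': "morphism (Grass_space (m + 1) (n + 1)) Z \<psi>' \<and> (\<forall>x\<in>AR_ss n m. \<psi>' (sys_subspace n m x) = f x)"
      and "W \<in> topspace (topo (Grass_space (m + 1) (n + 1)))"
    then have "W \<in> Grass (m + 1) (n + 1)" by (simp add: topspace_Grass_space)
    then obtain x where x: "x \<in> AR_ss n m" "W = sys_subspace n m x"
      unfolding sys_subspace_surj[symmetric] by blast
    then show "\<psi>' W = \<psi> W" using \<psi>' \<psi>[OF x(1)] by simp
  qed
qed

section \<open>Closed orbits and semi-stability in terms of nondegeneracy\<close>

lemma closedin_fibre:
  assumes "W \<in> Grass (m + 1) (n + 1)"
  shows "closedin (topo (AR_ss_space n m)) {x \<in> AR_ss n m. sys_subspace n m x = W}"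
proof -
  let ?k = "m + 1" and ?N = "n + 1"
  have ps: "pluecker ?k ?N ` Grass ?k ?N \<subseteq> proj_space (pluecker_index ?k ?N)"
    by (rule pluecker_in_proj_space) simp
  \<comment> \<open>A projective point is closed; by injectivity of the embedding it pulls back to
    the single subspace \<open>W\<close>, and by continuity of the subspace map to the whole
    fibre.\<close>
  have "closedin (zariski (pluecker_index ?k ?N)) {pluecker ?k ?N W}"
    by (rule closedin_zariski_point[OF finite_pluecker_index]) (use ps assms in blast)
  from closedin_embedded_preimage[OF ps this]
  have "closedin (topo (Grass_space ?k ?N)) {W' \<in> Grass ?k ?N. pluecker ?k ?N W' \<in> {pluecker ?k ?N W}}"
    unfolding Grass_space_def .
  also have "{W' \<in> Grass ?k ?N. pluecker ?k ?N W' \<in> {pluecker ?k ?N W}} = {W}"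
    using inj_on_pluecker[of ?k ?N] assms unfolding inj_on_def by auto
  finally have "closedin (topo (Grass_space ?k ?N)) {W}" .
  moreover have "continuous_map (topo (AR_ss_space n m)) (topo (Grass_space ?k ?N)) (sys_subspace n m)"
    using morphism_sys_subspace unfolding morphism_def by blast
  ultimately have "closedin (topo (AR_ss_space n m))
      {x \<in> topspace (topo (AR_ss_space n m)). sys_subspace n m x \<in> {W}}"
    by (rule closedin_continuous_map_preimage[rotated])
  then show ?thesis unfolding topspace_AR_ss_space by simp
qed

text \<open>Each fibre is nonempty, closed and a single orbit, so it is the only orbit that it
  contains.\<close>

lemma fibres_unique_closed_orbit_sys_subspace:
  "fibres_have_unique_closed_orbit (GL (m + 1)) feedback (AR_ss_space n m)
    (Grass (m + 1) (n + 1)) (sys_subspace n m)"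
  unfolding fibres_have_unique_closed_orbit_def topspace_AR_ss_space
proof
  fix W assume W: "W \<in> Grass (m + 1) (n + 1)"
  then obtain x where x: "x \<in> AR_ss n m" "sys_subspace n m x = W"
    unfolding sys_subspace_surj[symmetric] by blast
  let ?S = "{x \<in> AR_ss n m. sys_subspace n m x = W}"
  show "\<exists>!S. S \<in> orbit (GL (m + 1)) feedback ` AR_ss n m \<and>
      closedin (topo (AR_ss_space n m)) S \<and> S \<subseteq> ?S"
  proof (intro ex1I[of _ ?S] conjI)
    show "?S \<in> orbit (GL (m + 1)) feedback ` AR_ss n m"
      using orbit_eq_fibre[OF x(1)] x by blast
    show "closedin (topo (AR_ss_space n m)) ?S" by (rule closedin_fibre[OF W])
    fix S assume "S \<in> orbit (GL (m + 1)) feedback ` AR_ss n m \<and>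
      closedin (topo (AR_ss_space n m)) S \<and> S \<subseteq> ?S"
    then obtain y where y: "y \<in> AR_ss n m" "S = orbit (GL (m + 1)) feedback y" "S \<subseteq> ?S" by blast
    then have S: "S = {z \<in> AR_ss n m. sys_subspace n m z = sys_subspace n m y}"
      using orbit_eq_fibre by simp
    then have "y \<in> S" using y(1) by simp
    then have "sys_subspace n m y = W" using y(3) by blast
    then show "S = ?S" using S by simp
  qed simp
qed

lemma AR_ss_eq_nondegenerate:
  "AR_ss n m = {x \<in> AR n m. \<forall>R\<in>x. nondegenerate m (dehom R)}"
proof -
  have "semistable n m x \<longleftrightarrow> (\<forall>R\<in>x. nondegenerate m (dehom R))" if x: "x \<in> AR n m" for x
  proof -
    have iff: "nondegenerate m (dehom R) \<longleftrightarrow> semistable n m x" if R: "R \<in> x" for R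
      using nondegenerate_iff_row_indep[OF dehom_poly_rows[OF ARE(1)[OF x R]]] semistable_iff[OF x R]
      unfolding sys_mat_def by simp
    then show ?thesis using AR_nonempty[OF x] by blast
  qed
  then show ?thesis unfolding AR_ss_def by blast
qed

theorem mainTheorem3:
  fixes n m :: nat
  shows
    "bij_betw dehom (form_rows n m) (poly_rows n m)
     \<and> bij_betw (AR_proj n m) (AR n m) (proj_space {..m * n + m + n})
     \<and> bij_betw (coeff_vec n) {p. degree p \<le> n} (carrier_vec (n + 1))
     \<and> (\<forall>P \<in> poly_rows n m. nondegenerate m P \<longrightarrow> m \<le> n)
     \<and> (\<forall>P \<in> poly_rows n m.
          subspace_dim (n + 1) (poly_span n m P) = m + 1 \<longleftrightarrow> nondegenerate m P)
     \<and> AR_ss n m = {x \<in> AR n m. \<forall>R\<in>x. nondegenerate m (dehom R)}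
     \<and> (\<forall>x \<in> AR_ss n m. sys_subspace n m x \<in> Grass (m + 1) (n + 1)
          \<and> (\<forall>R\<in>x. poly_span n m (dehom R) = sys_subspace n m x))
     \<and> (m \<le> n \<longrightarrow>
          openin (zariski {..m * n + m + n}) (AR_proj n m ` AR_ss n m)
          \<and> projective_variety (pluecker_index (m + 1) (n + 1)) (pluecker (m + 1) (n + 1))
              (Grass (m + 1) (n + 1))
          \<and> categorical_quotient TYPE('z) (GL (m + 1)) feedback (AR_ss_space n m)
              (Grass_space (m + 1) (n + 1)) (sys_subspace n m)
          \<and> fibres_have_unique_closed_orbit (GL (m + 1)) feedback (AR_ss_space n m)
              (Grass (m + 1) (n + 1)) (sys_subspace n m))"
proof (intro conjI ballI impI)
  show "bij_betw dehom (form_rows n m) (poly_rows n m)" by (rule dehom_bij)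
  show "bij_betw (AR_proj n m) (AR n m) (proj_space {..m * n + m + n})" by (rule AR_proj_bij)
  show "bij_betw (coeff_vec n) {p. degree p \<le> n} (carrier_vec (n + 1))" by (rule coeff_vec_bij)
  show "m \<le> n" if "P \<in> poly_rows n m" "nondegenerate m P" for P
    using row_indep_dim_le[OF poly_mat_carrier] nondegenerate_iff_row_indep[OF that(1)] that(2) by simp
  show "subspace_dim (n + 1) (poly_span n m P) = m + 1 \<longleftrightarrow> nondegenerate m P"
    if "P \<in> poly_rows n m" for P
    unfolding poly_span_eq_row_space nondegenerate_iff_row_indep[OF that]
    by (rule subspace_dim_row_space_iff[OF poly_mat_carrier])
  show "AR_ss n m = {x \<in> AR n m. \<forall>R\<in>x. nondegenerate m (dehom R)}" by (rule AR_ss_eq_nondegenerate)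
  show "sys_subspace n m x \<in> Grass (m + 1) (n + 1)" if "x \<in> AR_ss n m" for x
    using sys_subspace_eq(3)[OF that] AR_ss_nonempty[OF that] by blast
  show "poly_span n m (dehom R) = sys_subspace n m x" if "x \<in> AR_ss n m" "R \<in> x" for x R
    by (rule sys_subspace_eq(2)[OF that])
  show "openin (zariski {..m * n + m + n}) (AR_proj n m ` AR_ss n m)" by (rule openin_AR_ss)
  \<comment> \<open>The bound \<open>m \<le> n\<close> becomes \<open>m + 1 \<le> n + 1\<close>,
    which provides a subspace of this dimension and so the nonemptiness contained in
    irreducibility.\<close>
  show "projective_variety (pluecker_index (m + 1) (n + 1)) (pluecker (m + 1) (n + 1))
      (Grass (m + 1) (n + 1))" if "m \<le> n"
    using projective_variety_Grass[of "m + 1" "n + 1"] that by simp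
  show "categorical_quotient TYPE('z) (GL (m + 1)) feedback (AR_ss_space n m)
      (Grass_space (m + 1) (n + 1)) (sys_subspace n m)" by (rule categorical_quotient_sys_subspace)
  show "fibres_have_unique_closed_orbit (GL (m + 1)) feedback (AR_ss_space n m)
      (Grass (m + 1) (n + 1)) (sys_subspace n m)" by (rule fibres_unique_closed_orbit_sys_subspace)
qed

end
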